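(* Every simple unital diagonal AH algebra has stable rank one.
   Context: For compact metric spaces $X,Y$, a $*$-homomorphism $\psi:\mathrm{M}_m(\mathrm{C}(X))\to \mathrm{M}_{nm}(\mathrm{C}(Y))$ is called diagonal if there are continuous maps $\lambda_1,\dots,\lambda_n:Y\to X$ with $\psi(f)=\mathrm{diag}(f\circ\lambda_1,\dots,f\circ\lambda_n)$ (each $f\circ\lambda_s$ an $m\times m$ block). A unital $*$-homomorphism $\psi:\bigoplus_{s=1}^n \mathrm{M}_{n_s}(\mathrm{C}(X_s))\to \mathrm{M}_k(\mathrm{C}(Y))$ is diagonal if there are natural numbers $k_1,\dots,k_n$ (zero allowed) with $\sum_s k_s=k$, $n_s\mid k_s$, a (block) embedding $\bigoplus_s \mathrm{M}_{k_s}\hookrightarrow \mathrm{M}_k$, and diagonal maps $\psi_s:\mathrm{M}_{n_s}(\mathrm{C}(X_s))\to \mathrm{M}_{k_s}(\mathrm{C}(Y))$ with $\psi=\bigoplus_s\psi_s$; a unital $*$-homomorphism into $\bigoplus_l\mathrm{M}_{m_l}(\mathrm{C}(Y_l))$ is diagonal if each of its components is diagonal. A diagonal AH algebra is the inductive limit of a sequence $(A_i,\phi_i)$ with $A_i=\bigoplus_{t=1}^{k_i}\mathrm{M}_{n_{i,t}}(\mathrm{C}(X_{i,t}))$, each $X_{i,t}$ a connected compact metric space, and each $\phi_i:A_i\to A_{i+1}$ a unital diagonal $*$-homomorphism. A unital C$^*$-algebra has stable rank one if its invertible elements are dense. *)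

theory Defs
  imports "HOL-Analysis.Analysis"
begin

text \<open>
Elements of a finite direct sum  A = (+)_{t<k} M_{n t}(C(X t))  are represented by
functions  f :: nat => 'a => nat => nat => complex ,  f t x r c  being the (r,c) entry
of the t-th summand evaluated at the point x.  We use the canonical representative that
vanishes outside  t < k, x in X t, r < n t, c < n t.
\<close>

type_synonym 'a hom_elem = "nat \<Rightarrow> 'a \<Rightarrow> nat \<Rightarrow> nat \<Rightarrow> complex"

definition hom_carrier ::
  "nat \<Rightarrow> (nat \<Rightarrow> nat) \<Rightarrow> (nat \<Rightarrow> 'a::topological_space set) \<Rightarrow> 'a hom_elem set" where
  "hom_carrier k n X =
     {f. (\<forall>t<k. \<forall>r<n t. \<forall>c<n t. continuous_on (X t) (\<lambda>x. f t x r c)) \<and>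
         (\<forall>t x r c. \<not> (t < k \<and> x \<in> X t \<and> r < n t \<and> c < n t) \<longrightarrow> f t x r c = 0)}"

definition hom_add :: "'a hom_elem \<Rightarrow> 'a hom_elem \<Rightarrow> 'a hom_elem" where
  "hom_add f g = (\<lambda>t x r c. f t x r c + g t x r c)"

definition hom_mult :: "(nat \<Rightarrow> nat) \<Rightarrow> 'a hom_elem \<Rightarrow> 'a hom_elem \<Rightarrow> 'a hom_elem" where
  "hom_mult n f g = (\<lambda>t x r c. \<Sum>j<n t. f t x r j * g t x j c)"

definition hom_unit :: "nat \<Rightarrow> (nat \<Rightarrow> nat) \<Rightarrow> (nat \<Rightarrow> 'a set) \<Rightarrow> 'a hom_elem" where
  "hom_unit k n X = (\<lambda>t x r c. if t < k \<and> x \<in> X t \<and> r < n t \<and> r = c then 1 else 0)"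

definition mat_opnorm :: "nat \<Rightarrow> (nat \<Rightarrow> nat \<Rightarrow> complex) \<Rightarrow> real" where
  "mat_opnorm m M =
     Sup ((\<lambda>v. sqrt (\<Sum>r<m. (cmod (\<Sum>c<m. M r c * v c))\<^sup>2)) `
          {v :: nat \<Rightarrow> complex. (\<Sum>c<m. (cmod (v c))\<^sup>2) \<le> 1})"

definition hom_norm :: "nat \<Rightarrow> (nat \<Rightarrow> nat) \<Rightarrow> (nat \<Rightarrow> 'a set) \<Rightarrow> 'a hom_elem \<Rightarrow> real" where
  "hom_norm k n X f = (SUP t\<in>{..<k}. SUP x\<in>X t. mat_opnorm (n t) (f t x))"

text \<open>
Diagonal map from  (+)_{s<k} M_{n s}(C(X s))  to  (+)_{l<k'} M_{n' l}(C(X' l)).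
The l-th component is the standard block-diagonal matrix
  diag(f_0 o lam l 0 0, ..., f_0 o lam l 0 (mlt l 0 - 1), f_1 o lam l 1 0, ...),
i.e. summand s occurs  mlt l s  times (mlt l s = k_s / n_s), in order.
\<close>
definition diag_offset :: "(nat \<Rightarrow> nat) \<Rightarrow> (nat \<Rightarrow> nat) \<Rightarrow> nat \<Rightarrow> nat \<Rightarrow> nat" where
  "diag_offset n m s j = (\<Sum>s'<s. m s' * n s') + j * n s"

definition diag_map ::
  "nat \<Rightarrow> (nat \<Rightarrow> nat) \<Rightarrow> nat \<Rightarrow> (nat \<Rightarrow> nat) \<Rightarrow> (nat \<Rightarrow> 'a set)
   \<Rightarrow> (nat \<Rightarrow> nat \<Rightarrow> nat) \<Rightarrow> (nat \<Rightarrow> nat \<Rightarrow> nat \<Rightarrow> 'a \<Rightarrow> 'a) \<Rightarrow> 'a hom_elem \<Rightarrow> 'a hom_elem" where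
  "diag_map k n k' n' X' mlt lam f =
     (\<lambda>l y p q. if l < k' \<and> y \<in> X' l \<and> p < n' l \<and> q < n' l then
        (\<Sum>s<k. \<Sum>j<mlt l s. \<Sum>a<n s. \<Sum>b<n s.
           if p = diag_offset n (mlt l) s j + a \<and> q = diag_offset n (mlt l) s j + b
           then f s (lam l s j y) a b else 0)
      else 0)"

definition is_diagonal ::
  "nat \<Rightarrow> (nat \<Rightarrow> nat) \<Rightarrow> (nat \<Rightarrow> 'a::topological_space set) \<Rightarrow> nat \<Rightarrow> (nat \<Rightarrow> nat)
   \<Rightarrow> (nat \<Rightarrow> 'a set) \<Rightarrow> (nat \<Rightarrow> nat \<Rightarrow> nat) \<Rightarrow> (nat \<Rightarrow> nat \<Rightarrow> nat \<Rightarrow> 'a \<Rightarrow> 'a) \<Rightarrow> bool" where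
  "is_diagonal k n X k' n' X' mlt lam \<longleftrightarrow>
     (\<forall>l<k'. (\<Sum>s<k. mlt l s * n s) = n' l \<and>
        (\<forall>s<k. \<forall>j<mlt l s. continuous_on (X' l) (lam l s j) \<and> lam l s j ` X' l \<subseteq> X s))"

definition conn_map where
  "conn_map k n X mlt lam i =
     diag_map (k i) (n i) (k (Suc i)) (n (Suc i)) (X (Suc i)) (mlt i) (lam i)"

fun conn_iter where
  "conn_iter k n X mlt lam i 0 a = a"
| "conn_iter k n X mlt lam i (Suc j) a =
     conn_map k n X mlt lam (i + j) (conn_iter k n X mlt lam i j a)"

text \<open>
B (a real Banach algebra with unit) together with maps  mu i : A_i -> B  is (isometrically
isomorphic to) the inductive limit of the sequence: the mu i are unital algebra
homomorphisms compatible with the connecting maps, the norm of mu i a is the limit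
of the norms of the images of a at later stages, and the union of the images is dense.
\<close>
definition is_inductive_limit ::
  "(nat \<Rightarrow> nat) \<Rightarrow> (nat \<Rightarrow> nat \<Rightarrow> nat) \<Rightarrow> (nat \<Rightarrow> nat \<Rightarrow> 'a::topological_space set)
   \<Rightarrow> (nat \<Rightarrow> nat \<Rightarrow> nat \<Rightarrow> nat) \<Rightarrow> (nat \<Rightarrow> nat \<Rightarrow> nat \<Rightarrow> nat \<Rightarrow> 'a \<Rightarrow> 'a)
   \<Rightarrow> (nat \<Rightarrow> 'a hom_elem \<Rightarrow> 'b::{banach, real_normed_algebra_1}) \<Rightarrow> bool" where
  "is_inductive_limit k n X mlt lam \<mu> \<longleftrightarrow>
     (\<forall>i. \<forall>a\<in>hom_carrier (k i) (n i) (X i). \<forall>b\<in>hom_carrier (k i) (n i) (X i).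
         \<mu> i (hom_add a b) = \<mu> i a + \<mu> i b \<and> \<mu> i (hom_mult (n i) a b) = \<mu> i a * \<mu> i b) \<and>
     (\<forall>i. \<mu> i (hom_unit (k i) (n i) (X i)) = 1) \<and>
     (\<forall>i. \<forall>a\<in>hom_carrier (k i) (n i) (X i). \<mu> (Suc i) (conn_map k n X mlt lam i a) = \<mu> i a) \<and>
     (\<forall>i. \<forall>a\<in>hom_carrier (k i) (n i) (X i).
         (\<lambda>j. hom_norm (k (i + j)) (n (i + j)) (X (i + j)) (conn_iter k n X mlt lam i j a))
           \<longlonglongrightarrow> norm (\<mu> i a)) \<and>
     closure (\<Union>i. \<mu> i ` hom_carrier (k i) (n i) (X i)) = UNIV"

definition closed_ideal :: "'b::real_normed_algebra_1 set \<Rightarrow> bool" where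
  "closed_ideal I \<longleftrightarrow> closed I \<and> 0 \<in> I \<and> (\<forall>x\<in>I. \<forall>y\<in>I. x + y \<in> I) \<and>
     (\<forall>x\<in>I. \<forall>y. y * x \<in> I \<and> x * y \<in> I)"

definition simple_algebra :: "'b::real_normed_algebra_1 itself \<Rightarrow> bool" where
  "simple_algebra _ \<longleftrightarrow> (\<forall>I::'b set. closed_ideal I \<longrightarrow> I = {0} \<or> I = UNIV)"

definition stable_rank_one :: "'b::real_normed_algebra_1 itself \<Rightarrow> bool" where
  "stable_rank_one _ \<longleftrightarrow> closure {x::'b. \<exists>y. x * y = 1 \<and> y * x = 1} = UNIV"

end

theory Submission
  imports Defs "Jordan_Normal_Form.Char_Poly"
begin

text \<open>Call a point of the spectrum of \<open>A\<^bsub>i\<^esub>\<close> persistent if it is hit by an eigenvalue map at every later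
  stage. By compactness, \<open>f \<in> A\<^bsub>i\<^esub>\<close> becomes invertible in the limit unless \<open>f\<close> is a singular matrix at some
  persistent point \<open>x\<^sub>0\<close>. In that case, after multiplication by invertible constants and a small
  perturbation, a fixed row and column of \<open>f\<close> vanish near \<open>x\<^sub>0\<close>. Simplicity makes some eigenvalue map
  take values near \<open>x\<^sub>0\<close> at every point of a later stage, so the image of \<open>f\<close> there has a nonnegative nowhere
  vanishing kernel vector field (a sum of basis vectors weighted by bump functions), and likewise on the
  left. Such a field is the first column of an explicit invertible rank one update of the identity, so the
  first row and column can be made to vanish everywhere. One stage further on the element is block diagonal
  with a zero row and column in each block. If the blocks are at least as numerous as they are large, a
  permutation makes the element strictly triangular, hence nilpotent up to an invertible factor, hence a
  limit of invertibles. If the matrix sizes stay bounded, simplicity leaves at most one persistent point at a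
  late stage, and adding a small scalar makes \<open>f\<close> nonsingular there.\<close>

subsection \<open>Singular matrices\<close>

text \<open>Two obstacles shape the argument. A nowhere vanishing vector field on a compact space
  need not be a column of an invertible matrix of continuous functions. The fields met here have
  nonnegative entries, so their pairing with the all-ones vector is positive, and that pairing is
  exactly the determinant of the rank one update that completes them. The second obstacle is room.
  An element with a zero row and column in each block offers one free position per block, while its
  nonzero entries form a band whose width is a block size; the permutation needs at least as many
  free positions as the band is wide. Sizes beyond the square of the total size of the starting
  stage guarantee this; bounded sizes never do, hence the separate second case. The limit is only a
  real Banach algebra, known through limits of norms along the sequence. Estimates must therefore be
  uniform in the later stages, although the matrix sizes there grow. They are, because the image of
  an element stays block diagonal with blocks no larger than those of the starting stage.\<close>

definition singular :: "nat \<Rightarrow> (nat \<Rightarrow> nat \<Rightarrow> complex) \<Rightarrow> bool" where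
  "singular m M \<longleftrightarrow> (\<exists>v. (\<exists>j<m. v j \<noteq> 0) \<and> (\<forall>r<m. (\<Sum>c<m. M r c * v c) = 0))"

abbreviation to_mat :: "nat \<Rightarrow> (nat \<Rightarrow> nat \<Rightarrow> complex) \<Rightarrow> complex mat" where
  "to_mat m M \<equiv> mat m m (\<lambda>(r, c). M r c)"

text \<open>Kernel vectors become columns in the reduction; the determinant supplies continuity,
  closedness of the singular set and the passage to transposes.\<close>

lemma singular_iff_det: "singular m M \<longleftrightarrow> det (to_mat m M) = 0"
proof -
  have "singular m M \<longleftrightarrow>
    (\<exists>v. v \<in> carrier_vec m \<and> v \<noteq> 0\<^sub>v m \<and> to_mat m M *\<^sub>v v = 0\<^sub>v m)" (is "_ \<longleftrightarrow> ?R")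
  proof
    assume "singular m M"
    then obtain v where v: "\<exists>j<m. v j \<noteq> 0" "\<forall>r<m. (\<Sum>c<m. M r c * v c) = 0"
      by (auto simp: singular_def)
    have "vec m v \<noteq> 0\<^sub>v m"
      using v(1) by (metis index_vec index_zero_vec(1))
    moreover have "to_mat m M *\<^sub>v vec m v = 0\<^sub>v m"
      using v(2) by (auto simp: scalar_prod_def atLeast0LessThan)
    ultimately show ?R by (intro exI[of _ "vec m v"]) auto
  next
    assume ?R
    then obtain v where v: "v \<in> carrier_vec m" "v \<noteq> 0\<^sub>v m" "to_mat m M *\<^sub>v v = 0\<^sub>v m" by blast
    have "\<exists>j<m. v $ j \<noteq> 0"
      using v(1,2) by (metis carrier_vecD eq_vecI index_zero_vec)
    moreover have "(\<Sum>c<m. M r c * v $ c) = 0" if "r < m" for r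
    proof -
      have "(to_mat m M *\<^sub>v v) $ r = 0" using v(3) that by simp
      then show ?thesis using that v(1) by (simp add: scalar_prod_def atLeast0LessThan)
    qed
    ultimately show "singular m M"
      unfolding singular_def by (intro exI[of _ "\<lambda>j. v $ j"]) auto
  qed
  then show ?thesis using det_0_iff_vec_prod_zero[of "to_mat m M" m] by simp
qed

text \<open>Supplies a left kernel vector, by which a row can be cleared together with a
  column.\<close>

lemma singular_transpose: "singular m (\<lambda>r c. M c r) \<longleftrightarrow> singular m M"
proof -
  have "to_mat m (\<lambda>r c. M c r) = transpose_mat (to_mat m M)" by (intro eq_matI) auto
  then show ?thesis by (simp add: singular_iff_det det_transpose[of _ m])
qed

lemma continuous_on_det:
  fixes M :: "'a::topological_space \<Rightarrow> nat \<Rightarrow> nat \<Rightarrow> complex"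
  assumes "\<And>r c. r < m \<Longrightarrow> c < m \<Longrightarrow> continuous_on S (\<lambda>x. M x r c)"
  shows "continuous_on S (\<lambda>x. det (to_mat m (M x)))"
proof -
  have "det (to_mat m (M x)) = (\<Sum>p | p permutes {0..<m}. signof p * (\<Prod>i = 0..<m. M x i (p i)))" for x
    by (subst det_def'[of _ m])
       (auto intro!: sum.cong prod.cong dest: permutes_in_image simp: permutes_in_image[of _ "{0..<m}", simplified])
  moreover have "continuous_on S (\<lambda>x. \<Sum>p | p permutes {0..<m}. signof p * (\<Prod>i = 0..<m. M x i (p i)))"
    using assms by (auto intro!: continuous_intros simp: permutes_in_image[of _ "{0..<m}", simplified])
  ultimately show ?thesis by simp
qed

text \<open>Cramer's formula, so that continuity in the entries of \<open>M\<close> can be read off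
  from determinants.\<close>

definition entry_inverse :: "nat \<Rightarrow> (nat \<Rightarrow> nat \<Rightarrow> complex) \<Rightarrow> nat \<Rightarrow> nat \<Rightarrow> complex" where
  "entry_inverse m M r c = adj_mat (to_mat m M) $$ (r, c) / det (to_mat m M)"

lemma entry_inverse:
  assumes "\<not> singular m M" "r < m" "c < m"
  shows "(\<Sum>j<m. M r j * entry_inverse m M j c) = (if r = c then 1 else 0)"
    and "(\<Sum>j<m. entry_inverse m M r j * M j c) = (if r = c then 1 else 0)"
proof -
  let ?A = "to_mat m M"
  note adj = adj_mat[of ?A m, simplified]
  have d: "det ?A \<noteq> 0" using assms(1) by (simp add: singular_iff_det)
  have "(?A * adj_mat ?A) $$ (r, c) = (if r = c then det ?A else 0)"
    using adj(2) assms by simp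
  then have "(\<Sum>j<m. M r j * adj_mat ?A $$ (j, c)) = (if r = c then det ?A else 0)"
    using adj(1) assms by (simp add: scalar_prod_def atLeast0LessThan times_mat_def)
  then show "(\<Sum>j<m. M r j * entry_inverse m M j c) = (if r = c then 1 else 0)"
    using d by (simp add: entry_inverse_def sum_divide_distrib[symmetric])
  have "(adj_mat ?A * ?A) $$ (r, c) = (if r = c then det ?A else 0)"
    using adj(3) assms by simp
  then have "(\<Sum>j<m. adj_mat ?A $$ (r, j) * M j c) = (if r = c then det ?A else 0)"
    using adj(1) assms by (simp add: scalar_prod_def atLeast0LessThan times_mat_def)
  then show "(\<Sum>j<m. entry_inverse m M r j * M j c) = (if r = c then 1 else 0)"
    using d by (simp add: entry_inverse_def sum_divide_distrib[symmetric])
qed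

lemma continuous_on_entry_inverse:
  fixes M :: "'a::topological_space \<Rightarrow> nat \<Rightarrow> nat \<Rightarrow> complex"
  assumes M: "\<And>r c. r < m \<Longrightarrow> c < m \<Longrightarrow> continuous_on S (\<lambda>x. M x r c)"
    and ns: "\<And>x. x \<in> S \<Longrightarrow> \<not> singular m (M x)" and rc: "r < m" "c < m"
  shows "continuous_on S (\<lambda>x. entry_inverse m (M x) r c)"
proof -
  \<comment> \<open>The adjugate transposes: the minor for entry \<open>(r, c)\<close> omits row
    \<open>c\<close> and column \<open>r\<close>.\<close>
  define D where "D x = (\<lambda>i j. M x (if i < c then i else Suc i) (if j < r then j else Suc j))" for x
  have "continuous_on S (\<lambda>x. D x i j)" if "i < m - 1" "j < m - 1" for i j
    unfolding D_def using that by (intro M) auto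
  then have *: "continuous_on S (\<lambda>x. det (to_mat (m - 1) (D x)))"
    by (rule continuous_on_det)
  have "mat_delete (to_mat m (M x)) c r = to_mat (m - 1) (D x)" for x
    by (intro eq_matI) (auto simp: mat_delete_def D_def)
  then have "entry_inverse m (M x) r c
      = (-1) ^ (c + r) * det (to_mat (m - 1) (D x)) / det (to_mat m (M x))" for x
    using rc by (simp add: entry_inverse_def adj_mat_def cofactor_def)
  moreover have "continuous_on S (\<lambda>x. (-1) ^ (c + r) * det (to_mat (m - 1) (D x)) / det (to_mat m (M x)))"
    using ns by (intro continuous_intros * continuous_on_det M) (auto simp: singular_iff_det)
  ultimately show ?thesis by simp
qed

text \<open>A bad \<delta> is the negative of a root of the characteristic polynomial. That
  polynomial is monic, so it has finitely many roots, whereas the interval from 0 to \<epsilon> is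
  infinite.\<close>

lemma nonsingular_perturbation:
  assumes "0 < \<epsilon>"
  obtains \<delta> where "0 < \<delta>" "\<delta> < \<epsilon>"
    "\<not> singular m (\<lambda>r c. M r c + (if r = c then complex_of_real \<delta> else 0))"
proof -
  let ?A = "to_mat m M"
  let ?p = "char_poly ?A"
  have "?p \<noteq> 0" using degree_monic_char_poly[of ?A m] by (metis coeff_0 mat_carrier zero_neq_one)
  then have "finite {z. poly ?p z = 0}" by (rule poly_roots_finite)
  then have "finite ((\<lambda>z. - Re z) ` {z. poly ?p z = 0})" by simp
  then have "\<not> {0<..<\<epsilon>} \<subseteq> (\<lambda>z. - Re z) ` {z. poly ?p z = 0}"
    using assms infinite_Ioo finite_subset by blast
  then obtain \<delta> where \<delta>: "0 < \<delta>" "\<delta> < \<epsilon>" "\<delta> \<notin> (\<lambda>z. - Re z) ` {z. poly ?p z = 0}"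
    by (metis greaterThanLessThan_iff subsetI)
  then have "poly ?p (- complex_of_real \<delta>) \<noteq> 0" by force
  then have ne: "\<not> eigenvalue ?A (- complex_of_real \<delta>)" by (simp add: eigenvalue_root_char_poly[of _ m])
  have "\<not> singular m (\<lambda>r c. M r c + (if r = c then complex_of_real \<delta> else 0))"
  proof
    assume "singular m (\<lambda>r c. M r c + (if r = c then complex_of_real \<delta> else 0))"
    then obtain v where v: "\<exists>j<m. v j \<noteq> 0"
      "\<forall>r<m. (\<Sum>c<m. (M r c + (if r = c then complex_of_real \<delta> else 0)) * v c) = 0"
      by (auto simp: singular_def)
    have "(\<Sum>c<m. M r c * v c) = - complex_of_real \<delta> * v r" if "r < m" for r
    proof -
      have "(\<Sum>c<m. (M r c + (if r = c then complex_of_real \<delta> else 0)) * v c)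
        = (\<Sum>c<m. M r c * v c) + (\<Sum>c<m. if r = c then complex_of_real \<delta> * v c else 0)"
        by (subst sum.distrib[symmetric]) (auto intro!: sum.cong simp: distrib_right)
      with v(2) that show ?thesis by (simp add: eq_neg_iff_add_eq_0)
    qed
    then have "?A *\<^sub>v vec m v = - complex_of_real \<delta> \<cdot>\<^sub>v vec m v"
      by (auto simp: scalar_prod_def atLeast0LessThan)
    moreover have "vec m v \<noteq> 0\<^sub>v m" using v(1) by (metis index_vec index_zero_vec(1))
    ultimately have "eigenvalue ?A (- complex_of_real \<delta>)"
      unfolding eigenvalue_def eigenvector_def by (intro exI[of _ "vec m v"]) auto
    with ne show False by simp
  qed
  with \<delta> that show ?thesis by blast
qed

subsection \<open>Eigenvalue maps of the connecting homomorphisms\<close>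

lemma diag_offset_exists:
  assumes "p < (\<Sum>s<k. m s * n s)"
  shows "\<exists>s<k. \<exists>j<m s. \<exists>a<n s. p = diag_offset n m s j + a"
  using assms
proof (induction k)
  case (Suc k)
  show ?case
  proof (cases "p < (\<Sum>s<k. m s * n s)")
    case True
    then show ?thesis using Suc.IH less_Suc_eq by metis
  next
    case False
    define r where "r = p - (\<Sum>s<k. m s * n s)"
    have r: "p = (\<Sum>s<k. m s * n s) + r" "r < m k * n k" using False Suc.prems by (auto simp: r_def)
    then have "0 < n k" by (cases "n k") auto
    moreover have "r div n k < m k" using r(2) by (simp add: less_mult_imp_div_less)
    moreover have "p = diag_offset n m k (r div n k) + r mod n k"
      using r(1) by (simp add: diag_offset_def)
    ultimately show ?thesis by (metis lessI mod_less_divisor)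
  qed
qed simp

lemma diag_offset_less:
  assumes "s < s'" "j < m s" "a < n s"
  shows "diag_offset n m s j + a < diag_offset n m s' j' + a'"
proof -
  have "j * n s + a < Suc j * n s" using assms by simp
  also have "\<dots> \<le> m s * n s" using assms by (intro mult_right_mono) auto
  finally have "diag_offset n m s j + a < (\<Sum>s'<Suc s. m s' * n s')" by (simp add: diag_offset_def)
  also have "\<dots> \<le> (\<Sum>s<s'. m s * n s)" using assms by (intro sum_mono2) auto
  finally show ?thesis by (simp add: diag_offset_def)
qed

lemma diag_offset_unique:
  assumes "diag_offset n m s j + a = diag_offset n m s' j' + a'"
    and "j < m s" "a < n s" "j' < m s'" "a' < n s'"
  shows "s = s' \<and> j = j' \<and> a = a'"
proof -
  have s: "s = s'"
    using diag_offset_less[of s s' j m a n j' a'] diag_offset_less[of s' s j' m a' n j a] assms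
    by (metis less_irrefl linorder_neqE_nat)
  then have eq: "j * n s + a = j' * n s + a'" using assms(1) by (simp add: diag_offset_def)
  have "j = (j * n s + a) div n s" "j' = (j' * n s + a') div n s"
    using assms s by auto
  with eq s show ?thesis by simp
qed

text \<open>Inverse of the offset map: existence and uniqueness of the decomposition determine the
  choice for every position in range. It turns the fourfold sum of \<open>diag_map\<close> into a
  lookup.\<close>

definition block_of :: "nat \<Rightarrow> (nat \<Rightarrow> nat) \<Rightarrow> (nat \<Rightarrow> nat) \<Rightarrow> nat \<Rightarrow> nat \<times> nat \<times> nat" where
  "block_of k n m p =
     (SOME (s, j, a). s < k \<and> j < m s \<and> a < n s \<and> p = diag_offset n m s j + a)"

lemma block_of_eqI:
  assumes "s < k" "j < m s" "a < n s"
  shows "block_of k n m (diag_offset n m s j + a) = (s, j, a)"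
  unfolding block_of_def
proof (rule some_equality)
  fix x assume "case x of (s', j', a') \<Rightarrow> s' < k \<and> j' < m s' \<and> a' < n s' \<and>
    diag_offset n m s j + a = diag_offset n m s' j' + a'"
  then show "x = (s, j, a)" using diag_offset_unique[where m = m and n = n and s = s and j = j and a = a] assms(2,3) by (auto split: prod.splits)
qed (use assms in auto)

locale diag_system =
  fixes k :: "nat \<Rightarrow> nat"
    and n :: "nat \<Rightarrow> nat \<Rightarrow> nat"
    and X :: "nat \<Rightarrow> nat \<Rightarrow> 'a::metric_space set"
    and mlt :: "nat \<Rightarrow> nat \<Rightarrow> nat \<Rightarrow> nat"
    and lam :: "nat \<Rightarrow> nat \<Rightarrow> nat \<Rightarrow> nat \<Rightarrow> 'a \<Rightarrow> 'a"
  assumes compact_X: "\<And>i t. t < k i \<Longrightarrow> compact (X i t)"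
    and X_nonempty: "\<And>i t. t < k i \<Longrightarrow> X i t \<noteq> {}"
    and n_pos: "\<And>i t. t < k i \<Longrightarrow> 0 < n i t"
    and diagonal: "\<And>i. is_diagonal (k i) (n i) (X i) (k (Suc i)) (n (Suc i)) (X (Suc i))
                          (mlt i) (lam i)"
begin

abbreviation alg :: "nat \<Rightarrow> 'a hom_elem set" where
  "alg i \<equiv> hom_carrier (k i) (n i) (X i)"

abbreviation \<phi> :: "nat \<Rightarrow> nat \<Rightarrow> 'a hom_elem \<Rightarrow> 'a hom_elem" where
  "\<phi> \<equiv> conn_iter k n X mlt lam"

text \<open>The position \<open>p\<close> of the summand \<open>l\<close> of \<open>A\<^bsub>i+1\<^esub>\<close> lies in copy \<open>cpy1 i l p\<close> of the
  summand \<open>src1 i l p\<close> of \<open>A\<^bsub>i\<^esub>\<close>, at position \<open>loc1 i l p\<close> of that block.\<close>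

definition src1 :: "nat \<Rightarrow> nat \<Rightarrow> nat \<Rightarrow> nat" where
  "src1 i l p = fst (block_of (k i) (n i) (mlt i l) p)"

definition cpy1 :: "nat \<Rightarrow> nat \<Rightarrow> nat \<Rightarrow> nat" where
  "cpy1 i l p = fst (snd (block_of (k i) (n i) (mlt i l) p))"

definition loc1 :: "nat \<Rightarrow> nat \<Rightarrow> nat \<Rightarrow> nat" where
  "loc1 i l p = snd (snd (block_of (k i) (n i) (mlt i l) p))"

lemma position:
  assumes "l < k (Suc i)" "p < n (Suc i) l"
  shows "src1 i l p < k i" "cpy1 i l p < mlt i l (src1 i l p)" "loc1 i l p < n i (src1 i l p)"
    "p = diag_offset (n i) (mlt i l) (src1 i l p) (cpy1 i l p) + loc1 i l p"
proof -
  have "p < (\<Sum>s<k i. mlt i l s * n i s)"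
    using diagonal[of i] assms by (simp add: is_diagonal_def)
  from diag_offset_exists[OF this] obtain s j a where
    sja: "s < k i" "j < mlt i l s" "a < n i s" "p = diag_offset (n i) (mlt i l) s j + a" by blast
  then have "block_of (k i) (n i) (mlt i l) p = (s, j, a)" using block_of_eqI by simp
  with sja show "src1 i l p < k i" "cpy1 i l p < mlt i l (src1 i l p)"
    "loc1 i l p < n i (src1 i l p)"
    "p = diag_offset (n i) (mlt i l) (src1 i l p) (cpy1 i l p) + loc1 i l p"
    by (auto simp: src1_def cpy1_def loc1_def)
qed

lemma position_eqI:
  assumes "s < k i" "j < mlt i l s" "a < n i s"
  shows "src1 i l (diag_offset (n i) (mlt i l) s j + a) = s"
    "cpy1 i l (diag_offset (n i) (mlt i l) s j + a) = j"
    "loc1 i l (diag_offset (n i) (mlt i l) s j + a) = a"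
  using block_of_eqI[of s "k i" j "mlt i l" a "n i"] assms by (auto simp: src1_def cpy1_def loc1_def)

lemma offset_in_range:
  assumes "l < k (Suc i)" "s < k i" "j < mlt i l s" "a < n i s"
  shows "diag_offset (n i) (mlt i l) s j + a < n (Suc i) l"
proof -
  have "diag_offset (n i) (mlt i l) s j + a < diag_offset (n i) (mlt i l) (k i) 0 + 0"
    using assms by (intro diag_offset_less)
  also have "\<dots> = n (Suc i) l"
    using diagonal[of i] assms by (simp add: is_diagonal_def diag_offset_def)
  finally show ?thesis .
qed

text \<open>Each of \<open>p\<close> and \<open>q\<close> determines its summand, its copy and its
  local index, so at most one term of the fourfold sum survives.\<close>

lemma conn_map_eq:
  "conn_map k n X mlt lam i f l y p q =
    (if l < k (Suc i) \<and> y \<in> X (Suc i) l \<and> p < n (Suc i) l \<and> q < n (Suc i) l \<and>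
        src1 i l p = src1 i l q \<and> cpy1 i l p = cpy1 i l q
     then f (src1 i l p) (lam i l (src1 i l p) (cpy1 i l p) y) (loc1 i l p) (loc1 i l q) else 0)"
proof (cases "l < k (Suc i) \<and> y \<in> X (Suc i) l \<and> p < n (Suc i) l \<and> q < n (Suc i) l")
  case True
  define s0 j0 a0 s1 j1 a1 where d: "s0 = src1 i l p" "j0 = cpy1 i l p" "a0 = loc1 i l p"
    "s1 = src1 i l q" "j1 = cpy1 i l q" "a1 = loc1 i l q"
  note P = position[of l i p, folded d] and Q = position[of l i q, folded d]
  have "conn_map k n X mlt lam i f l y p q =
    (\<Sum>s<k i. \<Sum>j<mlt i l s. \<Sum>a<n i s. \<Sum>b<n i s.
       if p = diag_offset (n i) (mlt i l) s j + a \<and> q = diag_offset (n i) (mlt i l) s j + b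
       then f s (lam i l s j y) a b else 0)"
    using True by (simp add: conn_map_def diag_map_def)
  \<comment> \<open>The tests are nested with the innermost summation variable outermost, so that
    the sums collapse one after the other.\<close>
  also have "\<dots> = (\<Sum>s<k i. \<Sum>j<mlt i l s. \<Sum>a<n i s. \<Sum>b<n i s.
       if b = a1 then if a = a0 then if j = j0 then if s = s0 then
         (if s0 = s1 \<and> j0 = j1 then f s (lam i l s j y) a b else 0) else 0 else 0 else 0 else 0)"
  proof (intro sum.cong refl)
    fix s j a b assume *: "s \<in> {..<k i}" "j \<in> {..<mlt i l s}" "a \<in> {..<n i s}" "b \<in> {..<n i s}"
    have "p = diag_offset (n i) (mlt i l) s j + a \<longleftrightarrow> s = s0 \<and> j = j0 \<and> a = a0"
      using * P True position_eqI[of s i j l a] d by auto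
    moreover have "q = diag_offset (n i) (mlt i l) s j + b \<longleftrightarrow> s = s1 \<and> j = j1 \<and> b = a1"
      using * Q True position_eqI[of s i j l b] d by auto
    ultimately show "(if p = diag_offset (n i) (mlt i l) s j + a \<and> q = diag_offset (n i) (mlt i l) s j + b
       then f s (lam i l s j y) a b else 0) = (if b = a1 then if a = a0 then if j = j0 then if s = s0 then
         (if s0 = s1 \<and> j0 = j1 then f s (lam i l s j y) a b else 0) else 0 else 0 else 0 else 0)"
      by auto
  qed
  also have "\<dots> = (\<Sum>s<k i. \<Sum>j<mlt i l s. if a1 < n i s \<and> a0 < n i s then if j = j0 then if s = s0 then
         (if s0 = s1 \<and> j0 = j1 then f s (lam i l s j y) a0 a1 else 0) else 0 else 0 else 0)"
  proof (intro sum.cong refl)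
    fix s j
    show "(\<Sum>a<n i s. \<Sum>b<n i s. if b = a1 then if a = a0 then if j = j0 then if s = s0 then
         (if s0 = s1 \<and> j0 = j1 then f s (lam i l s j y) a b else 0) else 0 else 0 else 0 else 0) =
      (if a1 < n i s \<and> a0 < n i s then if j = j0 then if s = s0 then
         (if s0 = s1 \<and> j0 = j1 then f s (lam i l s j y) a0 a1 else 0) else 0 else 0 else 0)"
      by (cases "a1 < n i s"; cases "j = j0"; cases "s = s0") (simp_all add: sum.delta)
  qed
  also have "\<dots> = (\<Sum>s<k i. if s = s0 then if j0 < mlt i l s then if a1 < n i s \<and> a0 < n i s then
         (if s0 = s1 \<and> j0 = j1 then f s (lam i l s j0 y) a0 a1 else 0) else 0 else 0 else 0)"
  proof (intro sum.cong refl)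
    fix s assume "s \<in> {..<k i}"
    show "(\<Sum>j<mlt i l s. if a1 < n i s \<and> a0 < n i s then if j = j0 then if s = s0 then
         (if s0 = s1 \<and> j0 = j1 then f s (lam i l s j y) a0 a1 else 0) else 0 else 0 else 0) =
      (if s = s0 then if j0 < mlt i l s then if a1 < n i s \<and> a0 < n i s then
         (if s0 = s1 \<and> j0 = j1 then f s (lam i l s j0 y) a0 a1 else 0) else 0 else 0 else 0)"
      by (cases "s = s0"; cases "a1 < n i s"; cases "a0 < n i s") (simp_all add: sum.delta)
  qed
  also have "\<dots> = (if s0 = s1 \<and> j0 = j1 then f s0 (lam i l s0 j0 y) a0 a1 else 0)"
    using P Q True by (simp add: sum.delta)
  finally show ?thesis using True by (simp add: d)
next
  case False
  then have "conn_map k n X mlt lam i f l y p q = 0"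
    unfolding conn_map_def diag_map_def by (rule if_not_P)
  with False show ?thesis by auto
qed

text \<open>The same data for the composite \<open>A\<^bsub>i\<^esub> \<rightarrow> A\<^bsub>i+d\<^esub>\<close>; \<open>same i d l p q\<close> says that \<open>p\<close> and \<open>q\<close> belong
  to one block, and \<open>pt i d l p\<close> is the eigenvalue map of that block.\<close>

primrec src :: "nat \<Rightarrow> nat \<Rightarrow> nat \<Rightarrow> nat \<Rightarrow> nat" where
  "src i 0 l p = l"
| "src i (Suc d) l p = src i d (src1 (i + d) l p) (loc1 (i + d) l p)"

primrec loc :: "nat \<Rightarrow> nat \<Rightarrow> nat \<Rightarrow> nat \<Rightarrow> nat" where
  "loc i 0 l p = p"
| "loc i (Suc d) l p = loc i d (src1 (i + d) l p) (loc1 (i + d) l p)"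

primrec pt :: "nat \<Rightarrow> nat \<Rightarrow> nat \<Rightarrow> nat \<Rightarrow> 'a \<Rightarrow> 'a" where
  "pt i 0 l p y = y"
| "pt i (Suc d) l p y = pt i d (src1 (i + d) l p) (loc1 (i + d) l p)
     (lam (i + d) l (src1 (i + d) l p) (cpy1 (i + d) l p) y)"

primrec same :: "nat \<Rightarrow> nat \<Rightarrow> nat \<Rightarrow> nat \<Rightarrow> nat \<Rightarrow> bool" where
  "same i 0 l p q = True"
| "same i (Suc d) l p q = (src1 (i + d) l p = src1 (i + d) l q \<and> cpy1 (i + d) l p = cpy1 (i + d) l q \<and>
     same i d (src1 (i + d) l p) (loc1 (i + d) l p) (loc1 (i + d) l q))"

lemma src_loc_less:
  assumes "l < k (i + d)" "p < n (i + d) l"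
  shows "src i d l p < k i" "loc i d l p < n i (src i d l p)"
  using assms by (induction d arbitrary: l p) (auto simp: position)

lemma lam_maps:
  assumes "l < k (Suc i)" "p < n (Suc i) l"
  shows "continuous_on (X (Suc i) l) (lam i l (src1 i l p) (cpy1 i l p))"
    "lam i l (src1 i l p) (cpy1 i l p) ` X (Suc i) l \<subseteq> X i (src1 i l p)"
  using diagonal[of i] position[OF assms] assms by (auto simp: is_diagonal_def)

lemma pt_maps:
  assumes "l < k (i + d)" "p < n (i + d) l"
  shows "continuous_on (X (i + d) l) (pt i d l p) \<and> pt i d l p ` X (i + d) l \<subseteq> X i (src i d l p)"
  using assms
proof (induction d arbitrary: l p)
  case 0
  then show ?case by (simp add: image_subset_iff)
next
  case (Suc d)
  let ?s = "src1 (i + d) l p" and ?a = "loc1 (i + d) l p"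
  let ?g = "lam (i + d) l ?s (cpy1 (i + d) l p)"
  have pos: "l < k (Suc (i + d))" "p < n (Suc (i + d)) l" using Suc.prems by auto
  note P = position[OF pos] and L = lam_maps[OF pos]
  have IH: "continuous_on (X (i + d) ?s) (pt i d ?s ?a)" "pt i d ?s ?a ` X (i + d) ?s \<subseteq> X i (src i d ?s ?a)"
    using Suc.IH[of ?s ?a] P by auto
  have "continuous_on (X (Suc (i + d)) l) (\<lambda>y. pt i d ?s ?a (?g y))"
    using continuous_on_compose2[OF IH(1) L(1)] L(2) by blast
  then show ?case using IH(2) L(2) by auto
qed

lemma pt_in:
  assumes "l < k (i + d)" "p < n (i + d) l" "y \<in> X (i + d) l"
  shows "pt i d l p y \<in> X i (src i d l p)"
  using pt_maps[OF assms(1,2)] assms(3) by blast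

lemma same_refl: "same i d l p p"
  by (induction d arbitrary: l p) auto

text \<open>The last equation says that both positions have the same block start, written additively
  because subtraction of naturals truncates.\<close>

lemma sameD:
  assumes "same i d l p q" "l < k (i + d)" "p < n (i + d) l" "q < n (i + d) l"
  shows "src i d l q = src i d l p \<and> pt i d l q = pt i d l p \<and> p + loc i d l q = q + loc i d l p"
  using assms
proof (induction d arbitrary: l p q)
  case (Suc d)
  have pos: "l < k (Suc (i + d))" "p < n (Suc (i + d)) l" "q < n (Suc (i + d)) l" using Suc.prems by auto
  note P = position[OF pos(1,2)] and Q = position[OF pos(1,3)]
  have e: "src1 (i + d) l q = src1 (i + d) l p" "cpy1 (i + d) l q = cpy1 (i + d) l p"
    using Suc.prems by auto
  note IH = Suc.IH[of "src1 (i + d) l p" "loc1 (i + d) l p" "loc1 (i + d) l q"]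
  have "p + loc1 (i + d) l q = q + loc1 (i + d) l p" using P(4) Q(4) unfolding e by linarith
  then show ?case using IH Suc.prems P Q e by (auto simp: fun_eq_iff)
qed auto

text \<open>Allows moving from any position of a block to a prescribed row or column of that block,
  without changing the eigenvalue map.\<close>

lemma block_full:
  assumes "l < k (i + d)" "p < n (i + d) l" "a < n i (src i d l p)"
  shows "\<exists>q < n (i + d) l. same i d l p q \<and> loc i d l q = a"
  using assms
proof (induction d arbitrary: l p)
  case (Suc d)
  let ?s = "src1 (i + d) l p" and ?j = "cpy1 (i + d) l p"
  have pos: "l < k (Suc (i + d))" "p < n (Suc (i + d)) l" using Suc.prems by auto
  note P = position[OF pos]
  obtain b where b: "b < n (i + d) ?s" "same i d ?s (loc1 (i + d) l p) b" "loc i d ?s b = a"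
    using Suc.IH[of ?s "loc1 (i + d) l p"] P Suc.prems by auto
  let ?q = "diag_offset (n (i + d)) (mlt (i + d) l) ?s ?j + b"
  have "?q < n (Suc (i + d)) l" using offset_in_range P b pos by simp
  then show ?case using b position_eqI[OF P(1,2) b(1)] by (intro exI[of _ ?q]) auto
qed auto

lemma comp_position:
  "src i (d + e) l p = src i d (src (i + d) e l p) (loc (i + d) e l p)"
  "loc i (d + e) l p = loc i d (src (i + d) e l p) (loc (i + d) e l p)"
  "pt i (d + e) l p y = pt i d (src (i + d) e l p) (loc (i + d) e l p) (pt (i + d) e l p y)"
  by (induction e arbitrary: l p y) (simp_all add: add.assoc)

text \<open>This closed form replaces the recursion from here on. Membership of \<open>f\<close> in
  \<open>alg i\<close> enters at \<open>d = 0\<close>, where the formula says that \<open>f\<close>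
  vanishes out of range.\<close>

lemma conn_iter_eq:
  assumes "f \<in> alg i"
  shows "\<phi> i d f l y p q =
    (if l < k (i + d) \<and> y \<in> X (i + d) l \<and> p < n (i + d) l \<and> q < n (i + d) l \<and> same i d l p q
     then f (src i d l p) (pt i d l p y) (loc i d l p) (loc i d l q) else 0)"
proof (induction d arbitrary: l y p q)
  case 0
  then show ?case using assms by (auto simp: hom_carrier_def)
next
  case (Suc d)
  show ?case
  proof (cases "l < k (Suc (i + d)) \<and> y \<in> X (Suc (i + d)) l \<and> p < n (Suc (i + d)) l \<and> q < n (Suc (i + d)) l")
    case True
    then have "src1 (i + d) l p < k (i + d)" "loc1 (i + d) l p < n (i + d) (src1 (i + d) l p)"
      "loc1 (i + d) l q < n (i + d) (src1 (i + d) l q)"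
      "lam (i + d) l (src1 (i + d) l p) (cpy1 (i + d) l p) y \<in> X (i + d) (src1 (i + d) l p)"
      using lam_maps(2)[of l "i + d" p] by (auto simp: position)
    then show ?thesis using True by (auto simp: conn_map_eq Suc.IH)
  qed (auto simp: conn_map_eq)
qed

lemma conn_iter_closed:
  assumes "f \<in> alg i"
  shows "\<phi> i d f \<in> alg (i + d)"
proof -
  have "continuous_on (X (i + d) l) (\<lambda>y. \<phi> i d f l y p q)"
    if l: "l < k (i + d)" "p < n (i + d) l" "q < n (i + d) l" for l p q
  proof (cases "same i d l p q")
    case True
    note sl = src_loc_less[OF l(1,2)] src_loc_less[OF l(1,3)]
    have "continuous_on (X i (src i d l p)) (\<lambda>x. f (src i d l p) x (loc i d l p) (loc i d l q))"
      using assms sl sameD[OF True l] by (auto simp: hom_carrier_def)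
    then have "continuous_on (X (i + d) l) (\<lambda>y. f (src i d l p) (pt i d l p y) (loc i d l p) (loc i d l q))"
      using pt_maps[OF l(1,2)] continuous_on_compose2 by blast
    then show ?thesis by (rule continuous_on_eq) (use l True in \<open>simp add: conn_iter_eq[OF assms]\<close>)
  next
    case False
    then show ?thesis by (simp add: conn_iter_eq[OF assms])
  qed
  then show ?thesis by (auto simp: hom_carrier_def conn_iter_eq[OF assms])
qed

end

subsection \<open>Norm estimates\<close>

text \<open>A Schur test: Cauchy-Schwarz along the rows gives one factor \<open>N\<close>,
  exchanging the two sums and counting along the columns gives the other. The bound depends on the
  sparsity pattern \<open>S\<close> but not on the size \<open>m\<close>, which is what makes it
  uniform along the sequence.\<close>

lemma cmod_matrix_vector_le:
  fixes M :: "nat \<Rightarrow> nat \<Rightarrow> complex"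
  assumes c: "0 \<le> c"
    and M: "\<And>p q. p < m \<Longrightarrow> q < m \<Longrightarrow> cmod (M p q) \<le> (if S p q then c else 0)"
    and row: "\<And>p. p < m \<Longrightarrow> card {q. q < m \<and> S p q} \<le> N"
    and col: "\<And>q. q < m \<Longrightarrow> card {p. p < m \<and> S p q} \<le> N"
    and v: "(\<Sum>q<m. (cmod (v q))\<^sup>2) \<le> 1"
  shows "sqrt (\<Sum>p<m. (cmod (\<Sum>q<m. M p q * v q))\<^sup>2) \<le> N * c"
proof -
  have row_le: "(cmod (\<Sum>q<m. M p q * v q))\<^sup>2 \<le> c\<^sup>2 * N * (\<Sum>q<m. if S p q then (cmod (v q))\<^sup>2 else 0)"
    if p: "p < m" for p
  proof -
    let ?Q = "{q. q < m \<and> S p q}"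
    have "cmod (\<Sum>q<m. M p q * v q) \<le> (\<Sum>q<m. cmod (M p q) * cmod (v q))"
      by (rule order_trans[OF norm_sum]) (simp add: norm_mult)
    also have "\<dots> \<le> (\<Sum>q<m. if S p q then c * cmod (v q) else 0)"
    proof (rule sum_mono)
      fix q assume "q \<in> {..<m}"
      then show "cmod (M p q) * cmod (v q) \<le> (if S p q then c * cmod (v q) else 0)"
        using M[of p q] p mult_right_mono[of "cmod (M p q)" c "cmod (v q)"] by (auto split: if_splits)
    qed
    also have "\<dots> = c * (\<Sum>q\<in>?Q. cmod (v q))"
      by (simp add: sum_distrib_left sum.inter_filter[symmetric])
    finally have "(cmod (\<Sum>q<m. M p q * v q))\<^sup>2 \<le> (c * (\<Sum>q\<in>?Q. cmod (v q)))\<^sup>2"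
      by (intro power_mono) auto
    also have "\<dots> = c\<^sup>2 * (\<Sum>q\<in>?Q. cmod (v q))\<^sup>2" by (simp add: power_mult_distrib)
    also have "\<dots> \<le> c\<^sup>2 * ((\<Sum>q\<in>?Q. (cmod (v q))\<^sup>2) * card ?Q)"
      by (intro mult_left_mono sum_squared_le_sum_of_squares) auto
    also have "\<dots> \<le> c\<^sup>2 * ((\<Sum>q\<in>?Q. (cmod (v q))\<^sup>2) * N)"
      using row[OF p] by (intro mult_left_mono) (auto intro: sum_nonneg)
    also have "(\<Sum>q\<in>?Q. (cmod (v q))\<^sup>2) = (\<Sum>q<m. if S p q then (cmod (v q))\<^sup>2 else 0)"
      by (simp add: sum.inter_filter[symmetric])
    finally show ?thesis by (simp add: mult_ac)
  qed
  have "(\<Sum>p<m. (cmod (\<Sum>q<m. M p q * v q))\<^sup>2)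
      \<le> (\<Sum>p<m. c\<^sup>2 * N * (\<Sum>q<m. if S p q then (cmod (v q))\<^sup>2 else 0))"
    by (intro sum_mono) (use row_le in auto)
  also have "\<dots> = c\<^sup>2 * N * (\<Sum>q<m. \<Sum>p<m. if S p q then (cmod (v q))\<^sup>2 else 0)"
    by (subst sum.swap) (simp add: sum_distrib_left)
  also have "\<dots> = c\<^sup>2 * N * (\<Sum>q<m. card {p. p < m \<and> S p q} * (cmod (v q))\<^sup>2)"
    by (simp add: sum.inter_filter[symmetric])
  also have "\<dots> \<le> c\<^sup>2 * N * (\<Sum>q<m. N * (cmod (v q))\<^sup>2)"
    using col by (intro mult_left_mono sum_mono mult_right_mono) auto
  also have "\<dots> = (N * c)\<^sup>2 * (\<Sum>q<m. (cmod (v q))\<^sup>2)"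
    by (simp add: sum_distrib_left[symmetric] power_mult_distrib power2_eq_square)
  also have "\<dots> \<le> (N * c)\<^sup>2" using v mult_left_mono[OF v, of "(N * c)\<^sup>2"] by simp
  finally show ?thesis using c by (intro real_le_lsqrt) auto
qed

lemma mat_opnorm_le:
  fixes M :: "nat \<Rightarrow> nat \<Rightarrow> complex"
  assumes "0 \<le> c"
    and "\<And>p q. p < m \<Longrightarrow> q < m \<Longrightarrow> cmod (M p q) \<le> (if S p q then c else 0)"
    and "\<And>p. p < m \<Longrightarrow> card {q. q < m \<and> S p q} \<le> N"
    and "\<And>q. q < m \<Longrightarrow> card {p. p < m \<and> S p q} \<le> N"
  shows "mat_opnorm m M \<le> N * c"
  unfolding mat_opnorm_def
proof (rule cSup_least)
  have "(\<lambda>_. 0) \<in> {v :: nat \<Rightarrow> complex. (\<Sum>c<m. (cmod (v c))\<^sup>2) \<le> 1}" by simp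
  then have "{v :: nat \<Rightarrow> complex. (\<Sum>c<m. (cmod (v c))\<^sup>2) \<le> 1} \<noteq> {}" by (rule ex_in_conv[THEN iffD1, OF exI])
  then show "(\<lambda>v. sqrt (\<Sum>r<m. (cmod (\<Sum>c<m. M r c * v c))\<^sup>2)) `
      {v. (\<Sum>c<m. (cmod (v c))\<^sup>2) \<le> 1} \<noteq> {}" by (simp only: image_is_empty not_False_eq_True)
next
  fix x
  assume "x \<in> (\<lambda>v. sqrt (\<Sum>r<m. (cmod (\<Sum>c<m. M r c * v c))\<^sup>2)) ` {v. (\<Sum>c<m. (cmod (v c))\<^sup>2) \<le> 1}"
  then obtain v where v: "(\<Sum>c<m. (cmod (v c))\<^sup>2) \<le> 1"
    "x = sqrt (\<Sum>r<m. (cmod (\<Sum>c<m. M r c * v c))\<^sup>2)" by (auto simp only: image_iff mem_Collect_eq)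
  show "x \<le> N * c" unfolding v(2) by (rule cmod_matrix_vector_le[OF assms v(1)])
qed

lemma mat_opnorm_ge_entry:
  assumes "p < m"
  shows "cmod (M p p) \<le> mat_opnorm m M"
proof -
  \<comment> \<open>A crude bound, whose purpose is to make the set in \<open>mat_opnorm\<close>
    bounded above, so that its supremum dominates the value at a basis vector.\<close>
  define c where "c = (\<Sum>p<m. \<Sum>q<m. cmod (M p q))"
  have c: "cmod (M p q) \<le> c" if "p < m" "q < m" for p q
  proof -
    have "cmod (M p q) \<le> (\<Sum>q<m. cmod (M p q))" using that by (intro member_le_sum) auto
    also have "\<dots> \<le> c" unfolding c_def using that
      by (intro member_le_sum[of p "{..<m}" "\<lambda>p. \<Sum>q<m. cmod (M p q)"]) (auto intro: sum_nonneg)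
    finally show ?thesis .
  qed
  have "0 \<le> c" by (simp add: c_def sum_nonneg)
  let ?e = "\<lambda>q. if q = p then 1 else 0 :: complex"
  have "bdd_above ((\<lambda>v. sqrt (\<Sum>r<m. (cmod (\<Sum>c<m. M r c * v c))\<^sup>2)) ` {v. (\<Sum>c<m. (cmod (v c))\<^sup>2) \<le> 1})"
    using cmod_matrix_vector_le[of c m M "\<lambda>_ _. True" m] c \<open>0 \<le> c\<close> by (intro bdd_aboveI2) auto
  moreover have "?e \<in> {v. (\<Sum>c<m. (cmod (v c))\<^sup>2) \<le> 1}"
    using assms by (simp add: if_distrib[of cmod] if_distrib[of "\<lambda>x. x\<^sup>2"] cong: if_cong)
  ultimately have "sqrt (\<Sum>r<m. (cmod (\<Sum>c<m. M r c * ?e c))\<^sup>2) \<le> mat_opnorm m M"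
    unfolding mat_opnorm_def by (intro cSUP_upper)
  moreover have "(\<Sum>c<m. M r c * ?e c) = M r p" for r
    using assms by (simp add: if_distrib[of "\<lambda>x. _ * x"] cong: if_cong)
  moreover have "(cmod (M p p))\<^sup>2 \<le> (\<Sum>r<m. (cmod (M r p))\<^sup>2)"
    using assms by (intro member_le_sum[of p "{..<m}" "\<lambda>r. (cmod (M r p))\<^sup>2"]) auto
  then have "cmod (M p p) \<le> sqrt (\<Sum>r<m. (cmod (M r p))\<^sup>2)" by (rule real_le_rsqrt)
  ultimately show ?thesis by simp
qed

context diag_system
begin

lemma algI:
  assumes "\<And>t r c. t < k i \<Longrightarrow> r < n i t \<Longrightarrow> c < n i t \<Longrightarrow> continuous_on (X i t) (\<lambda>x. f t x r c)"
    and "\<And>t x r c. \<not> (t < k i \<and> x \<in> X i t \<and> r < n i t \<and> c < n i t) \<Longrightarrow> f t x r c = 0"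
  shows "f \<in> alg i"
  using assms by (auto simp: hom_carrier_def)

lemma alg_zero:
  assumes "f \<in> alg i" "\<not> (t < k i \<and> x \<in> X i t \<and> r < n i t \<and> c < n i t)"
  shows "f t x r c = 0"
  using assms unfolding hom_carrier_def by blast

lemma alg_continuous:
  assumes "f \<in> alg i" "t < k i" "r < n i t" "c < n i t"
  shows "continuous_on (X i t) (\<lambda>x. f t x r c)"
  using assms by (auto simp: hom_carrier_def)

lemma alg_unit: "hom_unit (k i) (n i) (X i) \<in> alg i"
proof (rule algI)
  fix t r c assume "t < k i" "r < n i t" "c < n i t"
  show "continuous_on (X i t) (\<lambda>x. hom_unit (k i) (n i) (X i) t x r c)"
    by (rule continuous_on_eq[of _ "\<lambda>_. if r = c then 1 else 0"])
       (use \<open>t < k i\<close> \<open>r < n i t\<close> in \<open>auto simp: hom_unit_def\<close>)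
qed (auto simp: hom_unit_def)

lemma alg_add: "f \<in> alg i \<Longrightarrow> g \<in> alg i \<Longrightarrow> hom_add f g \<in> alg i"
  by (rule algI) (auto simp: hom_add_def alg_zero intro!: continuous_intros alg_continuous)

lemma alg_diff: "f \<in> alg i \<Longrightarrow> g \<in> alg i \<Longrightarrow> (\<lambda>t x r c. f t x r c - g t x r c) \<in> alg i"
  by (rule algI) (auto simp: alg_zero intro!: continuous_intros alg_continuous)

lemma alg_mult:
  assumes "f \<in> alg i" "g \<in> alg i"
  shows "hom_mult (n i) f g \<in> alg i"
proof (rule algI)
  fix t x r c assume "\<not> (t < k i \<and> x \<in> X i t \<and> r < n i t \<and> c < n i t)"
  then have "f t x r j = 0 \<or> g t x j c = 0" for j
    using alg_zero[OF assms(1)] alg_zero[OF assms(2)] by blast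
  then show "hom_mult (n i) f g t x r c = 0" unfolding hom_mult_def by (intro sum.neutral) auto
qed (use assms in \<open>auto simp: hom_mult_def intro!: continuous_intros alg_continuous\<close>)

lemma alg_bounded:
  assumes "f \<in> alg i"
  obtains c :: real where "0 \<le> c" "\<And>t x r q. cmod (f t x r q) \<le> c"
proof -
  have "\<exists>b\<ge>0. \<forall>x\<in>X i t. cmod (f t x r q) \<le> b" if "t < k i" "r < n i t" "q < n i t" for t r q
  proof -
    have "bounded ((\<lambda>x. f t x r q) ` X i t)"
      using compact_continuous_image[OF alg_continuous[OF assms that] compact_X] that
      by (simp add: compact_imp_bounded)
    then show ?thesis unfolding bounded_pos by (meson imageI less_imp_le)
  qed
  then obtain b where b: "\<And>t r q. t < k i \<Longrightarrow> r < n i t \<Longrightarrow> q < n i t \<Longrightarrow>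
      0 \<le> b t r q \<and> (\<forall>x\<in>X i t. cmod (f t x r q) \<le> b t r q)"
    by metis
  define c :: real where "c = (\<Sum>t<k i. \<Sum>r<n i t. \<Sum>q<n i t. b t r q)"
  have "0 \<le> c" unfolding c_def using b by (intro sum_nonneg) auto
  moreover have "cmod (f t x r q) \<le> c" for t x r q
  proof (cases "t < k i \<and> x \<in> X i t \<and> r < n i t \<and> q < n i t")
    case True
    then have "cmod (f t x r q) \<le> b t r q" using b by blast
    also have "\<dots> \<le> (\<Sum>q<n i t. b t r q)"
      using True b by (intro member_le_sum) auto
    also have "\<dots> \<le> (\<Sum>r<n i t. \<Sum>q<n i t. b t r q)"
      using True b by (intro member_le_sum[of r "{..<n i t}" "\<lambda>r. \<Sum>q<n i t. b t r q"] sum_nonneg) auto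
    also have "\<dots> \<le> c"
      unfolding c_def using True b
      by (intro member_le_sum[of t "{..<k i}" "\<lambda>t. \<Sum>r<n i t. \<Sum>q<n i t. b t r q"] sum_nonneg) auto
    finally show ?thesis .
  next
    case False
    then show ?thesis using \<open>0 \<le> c\<close> alg_zero[OF assms] by simp
  qed
  ultimately show ?thesis using that by blast
qed

lemma hom_norm_ge_entry:
  assumes f: "f \<in> alg i" and "t < k i" "x \<in> X i t" "p < n i t"
  shows "cmod (f t x p p) \<le> hom_norm (k i) (n i) (X i) f"
proof -
  obtain c :: real where c: "0 \<le> c" "\<And>t x r q. cmod (f t x r q) \<le> c" using alg_bounded[OF f] by blast
  have "mat_opnorm (n i t) (f t x) \<le> n i t * c" for x t
    by (rule mat_opnorm_le[where S = "\<lambda>_ _. True"]) (use c in auto)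
  then have "bdd_above ((\<lambda>x. mat_opnorm (n i t) (f t x)) ` X i t)" by (intro bdd_aboveI2)
  then have "mat_opnorm (n i t) (f t x) \<le> (SUP x\<in>X i t. mat_opnorm (n i t) (f t x))"
    using assms(3) by (intro cSUP_upper)
  also have "\<dots> \<le> hom_norm (k i) (n i) (X i) f"
    unfolding hom_norm_def using assms(2) by (intro cSUP_upper) (auto simp: bdd_above_finite)
  finally show ?thesis using mat_opnorm_ge_entry[OF assms(4), of "f t x"] by simp
qed

text \<open>On one block \<open>loc\<close> is injective with values below the size of a summand of
  stage \<open>i\<close>. So the pattern \<open>same\<close> passes the Schur test with a constant
  independent of \<open>d\<close>.\<close>

lemma same_card:
  assumes l: "l < k (i + d)"
  shows "p < n (i + d) l \<Longrightarrow> card {q. q < n (i + d) l \<and> same i d l p q} \<le> (\<Sum>t<k i. n i t)"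
    and "q < n (i + d) l \<Longrightarrow> card {p. p < n (i + d) l \<and> same i d l p q} \<le> (\<Sum>t<k i. n i t)"
proof -
  \<comment> \<open>Phrased through equations instead of \<open>same\<close>, so that it serves rows
    and columns alike.\<close>
  have *: "card S \<le> (\<Sum>t<k i. n i t)"
    if p: "p < n (i + d) l" and S: "\<And>q. q \<in> S \<Longrightarrow> q < n (i + d) l \<and>
      src i d l q = src i d l p \<and> p + loc i d l q = q + loc i d l p" for p S
  proof -
    have "inj_on (loc i d l) S"
    proof (rule inj_onI)
      fix q q' assume "q \<in> S" "q' \<in> S" "loc i d l q = loc i d l q'"
      then show "q = q'" using S[of q] S[of q'] by linarith
    qed
    moreover have "loc i d l ` S \<subseteq> {..<n i (src i d l p)}"
    proof
      fix a assume "a \<in> loc i d l ` S"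
      then obtain q where "q \<in> S" "a = loc i d l q" by blast
      then show "a \<in> {..<n i (src i d l p)}" using S[of q] src_loc_less(2)[OF l, of q] by simp
    qed
    ultimately have "card S \<le> card {..<n i (src i d l p)}" by (intro card_inj_on_le) auto
    then have "card S \<le> n i (src i d l p)" by simp
    also have "\<dots> \<le> (\<Sum>t<k i. n i t)"
      using src_loc_less(1)[OF l p] by (intro member_le_sum) auto
    finally show ?thesis .
  qed
  show "card {q. q < n (i + d) l \<and> same i d l p q} \<le> (\<Sum>t<k i. n i t)" if p: "p < n (i + d) l"
    by (rule *[OF p]) (use sameD[OF _ l p] in auto)
  show "card {p. p < n (i + d) l \<and> same i d l p q} \<le> (\<Sum>t<k i. n i t)" if q: "q < n (i + d) l"
  proof (rule *[OF q])
    fix p assume "p \<in> {p. p < n (i + d) l \<and> same i d l p q}"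
    then show "p < n (i + d) l \<and> src i d l p = src i d l q \<and> q + loc i d l p = p + loc i d l q"
      using sameD[OF _ l _ q, of p] by auto
  qed
qed

end

section \<open>The limit algebra and its norm\<close>

locale diag_limit = diag_system k n X mlt lam
  for k :: "nat \<Rightarrow> nat"
    and n :: "nat \<Rightarrow> nat \<Rightarrow> nat"
    and X :: "nat \<Rightarrow> nat \<Rightarrow> 'a::metric_space set"
    and mlt :: "nat \<Rightarrow> nat \<Rightarrow> nat \<Rightarrow> nat"
    and lam :: "nat \<Rightarrow> nat \<Rightarrow> nat \<Rightarrow> nat \<Rightarrow> 'a \<Rightarrow> 'a" +
  fixes \<mu> :: "nat \<Rightarrow> 'a hom_elem \<Rightarrow> 'b::{banach, real_normed_algebra_1}"
  assumes limit: "is_inductive_limit k n X mlt lam \<mu>"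
begin

abbreviation one :: "nat \<Rightarrow> 'a hom_elem" where
  "one i \<equiv> hom_unit (k i) (n i) (X i)"

lemma \<mu>_add: "f \<in> alg i \<Longrightarrow> g \<in> alg i \<Longrightarrow> \<mu> i (hom_add f g) = \<mu> i f + \<mu> i g"
  and \<mu>_mult: "f \<in> alg i \<Longrightarrow> g \<in> alg i \<Longrightarrow> \<mu> i (hom_mult (n i) f g) = \<mu> i f * \<mu> i g"
  and \<mu>_one: "\<mu> i (one i) = 1"
  and \<mu>_conn_map: "f \<in> alg i \<Longrightarrow> \<mu> (Suc i) (conn_map k n X mlt lam i f) = \<mu> i f"
  and \<mu>_norm: "f \<in> alg i \<Longrightarrow>
    (\<lambda>d. hom_norm (k (i + d)) (n (i + d)) (X (i + d)) (\<phi> i d f)) \<longlonglongrightarrow> norm (\<mu> i f)"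
  and \<mu>_dense: "closure (\<Union>i. \<mu> i ` alg i) = UNIV"
  using limit unfolding is_inductive_limit_def by blast+

lemma \<mu>_diff:
  assumes "f \<in> alg i" "g \<in> alg i"
  shows "\<mu> i (\<lambda>t x r c. f t x r c - g t x r c) = \<mu> i f - \<mu> i g"
proof -
  have "hom_add (\<lambda>t x r c. f t x r c - g t x r c) g = f" by (simp add: hom_add_def)
  then show ?thesis using \<mu>_add[OF alg_diff[OF assms] assms(2)] by simp
qed

lemma alg_zero_elem: "(\<lambda>t x r c. 0) \<in> alg i"
  by (rule algI) auto

lemma \<mu>_zero: "\<mu> i (\<lambda>t x r c. 0) = 0"
  using \<mu>_diff[OF alg_zero_elem alg_zero_elem, of i] by simp

text \<open>Without summands the unit would be the zero element, but 1 and 0 differ in the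
  limit.\<close>

lemma k_pos: "0 < k i"
proof (rule ccontr)
  assume "\<not> 0 < k i"
  then have "one i = (\<lambda>t x r c. 0)" by (simp add: hom_unit_def)
  then show False using \<mu>_one[of i] \<mu>_zero[of i] by simp
qed

lemma \<mu>_conn_iter: "f \<in> alg i \<Longrightarrow> \<mu> (i + d) (\<phi> i d f) = \<mu> i f"
  by (induction d) (simp_all add: \<mu>_conn_map conn_iter_closed)

text \<open>The factor comes from the block sizes of stage \<open>i\<close>, so it survives the
  passage to the limit; the matrix sizes of the later stages would not do.\<close>

lemma norm_\<mu>_le:
  fixes c :: real
  assumes f: "f \<in> alg i" and c: "0 \<le> c" "\<And>t x r q. cmod (f t x r q) \<le> c"
  shows "norm (\<mu> i f) \<le> (\<Sum>t<k i. n i t) * c"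
proof (rule LIMSEQ_le_const2[OF \<mu>_norm[OF f]], intro exI allI impI)
  fix d
  have "mat_opnorm (n (i + d) t) (\<phi> i d f t x) \<le> (\<Sum>t<k i. n i t) * c" if "t < k (i + d)" for t x
    using same_card[OF that] c
    by (intro mat_opnorm_le[where S = "same i d t"]) (auto simp: conn_iter_eq[OF f])
  then show "hom_norm (k (i + d)) (n (i + d)) (X (i + d)) (\<phi> i d f) \<le> (\<Sum>t<k i. n i t) * c"
    unfolding hom_norm_def using k_pos[of "i + d"] X_nonempty
    by (intro cSUP_least) (auto simp: lessThan_empty_iff)
qed

text \<open>Diagonal entries of the images are values of \<open>f\<close> at eigenvalues, and each
  is dominated by the operator norm. Seeing a large value at every stage thus bounds the limit norm
  from below.\<close>

lemma norm_\<mu>_ge: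
  assumes f: "f \<in> alg i"
    and c: "\<And>d. \<exists>l y p. l < k (i + d) \<and> y \<in> X (i + d) l \<and> p < n (i + d) l \<and>
      c \<le> cmod (f (src i d l p) (pt i d l p y) (loc i d l p) (loc i d l p))"
  shows "c \<le> norm (\<mu> i f)"
proof (rule LIMSEQ_le_const[OF \<mu>_norm[OF f]], intro exI allI impI)
  fix d
  obtain l y p where p: "l < k (i + d)" "y \<in> X (i + d) l" "p < n (i + d) l"
    "c \<le> cmod (f (src i d l p) (pt i d l p y) (loc i d l p) (loc i d l p))" using c by blast
  then have "c \<le> cmod (\<phi> i d f l y p p)" by (simp add: conn_iter_eq[OF f] same_refl)
  also have "\<dots> \<le> hom_norm (k (i + d)) (n (i + d)) (X (i + d)) (\<phi> i d f)"
    using p by (intro hom_norm_ge_entry conn_iter_closed f)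
  finally show "c \<le> hom_norm (k (i + d)) (n (i + d)) (X (i + d)) (\<phi> i d f)" .
qed

end

subsection \<open>Simplicity\<close>

context diag_system
begin

lemma same_sym: "same i d l p q \<Longrightarrow> same i d l q p"
  by (induction d arbitrary: l p q) auto

lemma same_trans: "same i d l p q \<Longrightarrow> same i d l q r \<Longrightarrow> same i d l p r"
  by (induction d arbitrary: l p q r) auto

lemma loc_bij_betw:
  assumes l: "l < k (i + d)" and p: "p < n (i + d) l"
  shows "bij_betw (loc i d l) {q \<in> {..<n (i + d) l}. same i d l p q} {..<n i (src i d l p)}"
  unfolding bij_betw_def
proof (intro conjI inj_onI subset_antisym subsetI)
  fix q q' assume "q \<in> {q \<in> {..<n (i + d) l}. same i d l p q}"
    "q' \<in> {q \<in> {..<n (i + d) l}. same i d l p q}" "loc i d l q = loc i d l q'"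
  then show "q = q'"
    using sameD[OF _ l p, of q] sameD[OF _ l p, of q'] by (metis (lifting) add.commute add_left_cancel lessThan_iff mem_Collect_eq)
next
  fix a assume "a \<in> loc i d l ` {q \<in> {..<n (i + d) l}. same i d l p q}"
  then obtain q where "q < n (i + d) l" "same i d l p q" "a = loc i d l q" by blast
  then show "a \<in> {..<n i (src i d l p)}"
    using sameD[OF _ l p, of q] src_loc_less(2)[OF l, of q] by simp
next
  fix a assume "a \<in> {..<n i (src i d l p)}"
  then show "a \<in> loc i d l ` {q \<in> {..<n (i + d) l}. same i d l p q}"
    using block_full[OF l p, of a] by blast
qed

text \<open>Restrict a kernel vector of the image to a block on which it does not vanish.\<close>

lemma singular_block:
  assumes f: "f \<in> alg i" and l: "l < k (i + d)" "y \<in> X (i + d) l"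
    and sing: "singular (n (i + d) l) (\<phi> i d f l y)"
  shows "\<exists>p < n (i + d) l. singular (n i (src i d l p)) (f (src i d l p) (pt i d l p y))"
proof -
  obtain v p where p: "p < n (i + d) l" "v p \<noteq> 0"
    and v: "\<forall>r<n (i + d) l. (\<Sum>q<n (i + d) l. \<phi> i d f l y r q * v q) = 0"
    using sing by (auto simp: singular_def)
  let ?Q = "{q \<in> {..<n (i + d) l}. same i d l p q}"
  let ?F = "f (src i d l p) (pt i d l p y)"
  \<comment> \<open>The vector \<open>v\<close> in local coordinates: \<open>p\<close> minus its
    local index is the start of the block.\<close>
  define w where "w a = v (p + a - loc i d l p)" for a
  have w_loc: "w (loc i d l q) = v q" if "q \<in> ?Q" for q
    using sameD[of i d l p q] that l p unfolding w_def by (simp add: algebra_simps)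
  have "w (loc i d l p) \<noteq> 0" using p w_loc[of p] by (simp add: same_refl)
  moreover have "(\<Sum>a<n i (src i d l p). ?F r a * w a) = 0" if r: "r < n i (src i d l p)" for r
  proof -
    obtain p' where p': "p' < n (i + d) l" "same i d l p p'" "loc i d l p' = r"
      using block_full[OF l(1) p(1) r] by blast
    note D = sameD[OF p'(2) l(1) p(1) p'(1)]
    have "(\<Sum>a<n i (src i d l p). ?F r a * w a) = (\<Sum>q\<in>?Q. ?F r (loc i d l q) * w (loc i d l q))"
      by (rule sum.reindex_bij_betw[OF loc_bij_betw[OF l(1) p(1)], symmetric])
    also have "\<dots> = (\<Sum>q\<in>?Q. ?F r (loc i d l q) * v q)" using w_loc by simp
    also have "\<dots> = (\<Sum>q<n (i + d) l. if same i d l p q then ?F r (loc i d l q) * v q else 0)"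
      by (rule sum.inter_filter) simp
    also have "\<dots> = (\<Sum>q<n (i + d) l. \<phi> i d f l y p' q * v q)"
    proof (intro sum.cong refl)
      fix q assume "q \<in> {..<n (i + d) l}"
      moreover have "same i d l p q \<longleftrightarrow> same i d l p' q"
        using same_trans same_sym p'(2) by blast
      ultimately show "(if same i d l p q then ?F r (loc i d l q) * v q else 0) = \<phi> i d f l y p' q * v q"
        using l p'(1,3) conjunct1[OF D] conjunct1[OF conjunct2[OF D]] by (simp add: conn_iter_eq[OF f])
    qed
    finally show ?thesis using v p' by simp
  qed
  ultimately have "singular (n i (src i d l p)) ?F"
    unfolding singular_def using src_loc_less(2)[OF l(1) p(1)] by blast
  then show ?thesis using p by blast
qed

lemma nonsingular_invertible:
  assumes f: "f \<in> alg i"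
    and ns: "\<And>t x. t < k i \<Longrightarrow> x \<in> X i t \<Longrightarrow> \<not> singular (n i t) (f t x)"
  obtains g where "g \<in> alg i" "hom_mult (n i) f g = hom_unit (k i) (n i) (X i)"
    "hom_mult (n i) g f = hom_unit (k i) (n i) (X i)"
proof -
  define g where "g t x r c = (if t < k i \<and> x \<in> X i t \<and> r < n i t \<and> c < n i t
    then entry_inverse (n i t) (f t x) r c else 0)" for t x r c
  have g: "g \<in> alg i"
  proof (rule algI)
    fix t r c assume trc: "t < k i" "r < n i t" "c < n i t"
    have "continuous_on (X i t) (\<lambda>x. entry_inverse (n i t) (f t x) r c)"
      using trc by (intro continuous_on_entry_inverse alg_continuous f ns)
    then show "continuous_on (X i t) (\<lambda>x. g t x r c)"
      by (rule continuous_on_eq) (simp add: g_def trc)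
  qed (auto simp: g_def)
  have "hom_mult (n i) f g t x r c = hom_unit (k i) (n i) (X i) t x r c \<and>
    hom_mult (n i) g f t x r c = hom_unit (k i) (n i) (X i) t x r c" for t x r c
  proof (cases "t < k i \<and> x \<in> X i t \<and> r < n i t \<and> c < n i t")
    case True
    then show ?thesis using entry_inverse[of "n i t" "f t x" r c] ns[of t x]
      by (simp add: hom_mult_def hom_unit_def g_def)
  next
    case False
    then show ?thesis
      using alg_zero[OF alg_mult[OF f g] False] alg_zero[OF alg_mult[OF g f] False]
        alg_zero[OF alg_unit False] by simp
  qed
  then show ?thesis by (intro that[OF g]) (auto simp: fun_eq_iff)
qed

section \<open>Persistent points and compactness\<close>

definition persistent :: "nat \<Rightarrow> nat \<Rightarrow> 'a \<Rightarrow> bool" where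
  "persistent i t x \<longleftrightarrow> (\<forall>d. \<exists>l y p. l < k (i + d) \<and> y \<in> X (i + d) l \<and> p < n (i + d) l \<and>
     src i d l p = t \<and> pt i d l p y = x)"

lemma persistent_in: "persistent i t x \<Longrightarrow> t < k i \<and> x \<in> X i t"
  unfolding persistent_def by (drule spec[of _ 0]) auto

text \<open>The points of stage \<open>i\<close> hit from stage \<open>i + d\<close> form a compact
  set that shrinks as \<open>d\<close> grows, because later eigenvalue maps factor through earlier
  ones. Intersecting with the closed set of zeros of the determinant keeps this, and the finite
  intersection property gives a point common to all stages.\<close>

lemma persistent_singular:
  assumes f: "f \<in> alg i"
    and sing: "\<And>d. \<exists>l y p. l < k (i + d) \<and> y \<in> X (i + d) l \<and> p < n (i + d) l \<and>
      singular (n i (src i d l p)) (f (src i d l p) (pt i d l p y))"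
  obtains t x where "persistent i t x" "singular (n i t) (f t x)"
proof -
  define C where "C d t = {x. \<exists>l y p. l < k (i + d) \<and> y \<in> X (i + d) l \<and> p < n (i + d) l \<and>
    src i d l p = t \<and> pt i d l p y = x}" for d t
  define D where "D d t = C d t \<inter> {x \<in> X i t. singular (n i t) (f t x)}" for d t
  have "C (d + e) t \<subseteq> C d t" for d e t
  proof
    fix x assume "x \<in> C (d + e) t"
    then obtain l y p where p: "l < k (i + d + e)" "y \<in> X (i + d + e) l" "p < n (i + d + e) l"
      "src i (d + e) l p = t" "pt i (d + e) l p y = x" by (auto simp: C_def add.assoc)
    then show "x \<in> C d t"
      unfolding C_def using src_loc_less[OF p(1,3)] pt_in[OF p(1,3,2)]
      by (intro CollectI exI[of _ "src (i + d) e l p"] exI[of _ "pt (i + d) e l p y"]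
          exI[of _ "loc (i + d) e l p"]) (simp add: comp_position)
  qed
  then have D_mono: "D e t \<subseteq> D d t" if "d \<le> e" for d e t
    using that unfolding D_def by (metis Int_mono le_add_diff_inverse order_refl)
  have D_compact: "compact (D d t)" if t: "t < k i" for d t
  proof -
    have "C d t = (\<Union>l\<in>{..<k (i + d)}. \<Union>p\<in>{p. p < n (i + d) l \<and> src i d l p = t}. pt i d l p ` X (i + d) l)"
      by (auto simp: C_def)
    moreover have "compact \<dots>"
      by (intro compact_UN) (auto intro!: compact_continuous_image compact_X simp: pt_maps)
    ultimately have C: "compact (C d t)" by simp
    have "continuous_on (X i t) (\<lambda>x. det (to_mat (n i t) (f t x)))"
      using t by (intro continuous_on_det alg_continuous f)
    then have "closed {x \<in> X i t. det (to_mat (n i t) (f t x)) = 0}"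
      using continuous_closed_preimage_constant[of "X i t"] compact_imp_closed[OF compact_X[OF t]] by blast
    then show ?thesis unfolding D_def singular_iff_det using C by (rule compact_Int_closed[rotated])
  qed
  have "\<exists>t<k i. \<forall>d. D d t \<noteq> {}"
  proof (rule ccontr)
    assume "\<not> ?thesis"
    then obtain d where d: "\<And>t. t < k i \<Longrightarrow> D (d t) t = {}" by metis
    \<comment> \<open>If each summand had some empty stage, this stage would lie past all of them,
      leaving no summand for the singular block found there.\<close>
    define e where "e = (\<Sum>t<k i. d t)"
    obtain l y p where p: "l < k (i + e)" "y \<in> X (i + e) l" "p < n (i + e) l"
      "singular (n i (src i e l p)) (f (src i e l p) (pt i e l p y))" using sing by blast
    have t: "src i e l p < k i" using src_loc_less[OF p(1,3)] by simp
    have "pt i e l p y \<in> D e (src i e l p)"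
      using p pt_in[OF p(1,3,2)] unfolding D_def C_def by blast
    moreover have "d (src i e l p) \<le> e" using t by (auto simp: e_def intro!: member_le_sum)
    ultimately show False using D_mono d[OF t] by blast
  qed
  then obtain t where t: "t < k i" "\<And>d. D d t \<noteq> {}" by blast
  have "D 0 t \<inter> (\<Inter>d\<in>UNIV. D d t) \<noteq> {}"
  proof (rule compact_imp_fip_image[OF D_compact[OF t(1)]])
    show "closed (D d t)" for d by (rule compact_imp_closed[OF D_compact[OF t(1)]])
    fix I :: "nat set" assume I: "finite I"
    have "D (\<Sum>I) t \<subseteq> D d t" if "d \<in> insert 0 I" for d
      using that member_le_sum[of d I id] I by (intro D_mono) auto
    then show "D 0 t \<inter> (\<Inter>d\<in>I. D d t) \<noteq> {}" using t(2)[of "\<Sum>I"] by blast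
  qed
  then obtain x where "\<And>d. x \<in> D d t" by blast
  then show ?thesis
    by (intro that[of t x]) (auto simp: persistent_def D_def C_def)
qed

definition near :: "nat \<Rightarrow> nat \<Rightarrow> 'a \<Rightarrow> real \<Rightarrow> nat \<Rightarrow> nat \<Rightarrow> 'a \<Rightarrow> bool" where
  "near i t x \<delta> d l y \<longleftrightarrow> (\<exists>p<n (i + d) l. src i d l p = t \<and> dist (pt i d l p y) x < \<delta>)"

text \<open>A block of the later stage contains a copy of every position of its source summand;
  moving inside the block to the copy of the position that witnesses nearness gives a composite
  eigenvalue near \<open>x\<close>.\<close>

lemma near_add:
  assumes l: "l < k (i + d + e)" and p: "p < n (i + d + e) l"
    and near: "near i t x \<delta> d (src (i + d) e l p) (pt (i + d) e l p y)"
  shows "near i t x \<delta> (d + e) l y"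
proof -
  obtain p' where p': "p' < n (i + d) (src (i + d) e l p)"
    "src i d (src (i + d) e l p) p' = t"
    "dist (pt i d (src (i + d) e l p) p' (pt (i + d) e l p y)) x < \<delta>"
    using near by (auto simp: near_def)
  obtain q where q: "q < n (i + d + e) l" "same (i + d) e l p q" "loc (i + d) e l q = p'"
    using block_full[OF l p p'(1)] by blast
  note D = sameD[OF q(2) l p q(1)]
  show ?thesis unfolding near_def
    by (intro exI[of _ q]) (use D p' q in \<open>simp add: comp_position add.assoc\<close>)
qed

end

context diag_limit
begin

lemma \<mu>_inverse:
  assumes "f \<in> alg i" "g \<in> alg i" "hom_mult (n i) f g = one i" "hom_mult (n i) g f = one i"
  shows "\<mu> i f * \<mu> i g = 1 \<and> \<mu> i g * \<mu> i f = 1"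
  using \<mu>_mult[OF assms(1,2)] \<mu>_mult[OF assms(2,1)] assms(3,4) \<mu>_one by simp

lemma invertible_or_persistent_singular:
  assumes f: "f \<in> alg i"
  shows "(\<exists>b. \<mu> i f * b = 1 \<and> b * \<mu> i f = 1) \<or> (\<exists>t x. persistent i t x \<and> singular (n i t) (f t x))"
proof (cases "\<exists>d. \<forall>l y p. l < k (i + d) \<and> y \<in> X (i + d) l \<and> p < n (i + d) l \<longrightarrow>
      \<not> singular (n i (src i d l p)) (f (src i d l p) (pt i d l p y))")
  case True
  then obtain d where d: "\<And>l y p. l < k (i + d) \<Longrightarrow> y \<in> X (i + d) l \<Longrightarrow> p < n (i + d) l \<Longrightarrow>
      \<not> singular (n i (src i d l p)) (f (src i d l p) (pt i d l p y))" by blast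
  then obtain g where "g \<in> alg (i + d)" "hom_mult (n (i + d)) (\<phi> i d f) g = one (i + d)"
    "hom_mult (n (i + d)) g (\<phi> i d f) = one (i + d)"
    using nonsingular_invertible[OF conn_iter_closed[OF f, of d]] singular_block[OF f] by metis
  then show ?thesis
    using \<mu>_inverse[OF conn_iter_closed[OF f]] \<mu>_conn_iter[OF f, of d] by metis
next
  case False
  then show ?thesis using persistent_singular[OF f] by metis
qed

text \<open>Suppose every stage has bad points, at which no eigenvalue comes near \<open>x\<close>.
  The elements vanishing at the bad points yield an ideal of the limit. It is not zero, since a bump
  at the persistent point \<open>x\<close> has norm at least one in the limit. It is proper, since
  an element vanishing at the bad points stays at distance at least one from the unit. This
  contradicts simplicity.\<close>

lemma persistent_near:
  assumes simple: "simple_algebra TYPE('b)"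
    and pers: "persistent i t x" and \<delta>: "0 < \<delta>"
  shows "\<exists>d. \<forall>l<k (i + d). \<forall>y\<in>X (i + d) l. near i t x \<delta> d l y"
proof (rule ccontr)
  assume neg: "\<not> ?thesis"
  define B where "B d l y \<longleftrightarrow> l < k (i + d) \<and> y \<in> X (i + d) l \<and> \<not> near i t x \<delta> d l y" for d l y
  have B_ex: "\<exists>l y. B d l y" for d using neg unfolding B_def by blast
  \<comment> \<open>Bad points are carried to bad points: otherwise \<open>near_add\<close> would
    make the original point near. Hence vanishing at bad points passes to later stages.\<close>
  have B_pull: "B d (src (i + d) e l p) (pt (i + d) e l p y)"
    if "B (d + e) l y" "p < n (i + d + e) l" for d e l p y
  proof -
    have l: "l < k (i + d + e)" "y \<in> X (i + d + e) l" using that by (auto simp: B_def add.assoc)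
    show ?thesis using that near_add[OF l(1) that(2)] src_loc_less[OF l(1) that(2)] pt_in[OF l(1) that(2) l(2)]
      unfolding B_def by blast
  qed
  define I where "I d = {a \<in> alg (i + d). \<forall>l y r c. B d l y \<longrightarrow> a l y r c = 0}" for d
  define U where "U = (\<Union>d. \<mu> (i + d) ` I d)"
  define W where "W = (\<Union>j. \<mu> j ` alg j)"
  have raise: "\<phi> (i + d) e a \<in> I (d + e)" if "a \<in> I d" for a d e
  proof -
    have a: "a \<in> alg (i + d)" using that by (simp add: I_def)
    have "\<phi> (i + d) e a l y r c = 0" if "B (d + e) l y" for l y r c
      using B_pull[OF that] \<open>a \<in> I d\<close> by (auto simp: conn_iter_eq[OF a] I_def)
    then show ?thesis using conn_iter_closed[OF a, of e] by (simp add: I_def add.assoc)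
  qed
  have U_E: "\<exists>d a. a \<in> I d \<and> u = \<mu> (i + d) a" if "u \<in> U" for u using that by (auto simp: U_def)
  have I_alg: "a \<in> alg (i + d)" if "a \<in> I d" for a d using that by (simp add: I_def)
  have U_I: "\<mu> (i + d) a \<in> U" if "a \<in> I d" for a d using that by (auto simp: U_def)
  have raised: "\<exists>a' \<in> I (d + e). \<mu> (i + (d + e)) a' = \<mu> (i + d) a" if "a \<in> I d" for a d e
    using raise[OF that, of e] \<mu>_conn_iter[OF I_alg[OF that], of e] by (metis add.assoc)
  have U_add: "u + v \<in> U" if uv: "u \<in> U" "v \<in> U" for u v
  proof -
    obtain d a e b where a: "a \<in> I d" "u = \<mu> (i + d) a" and b: "b \<in> I e" "v = \<mu> (i + e) b"
      using U_E uv by metis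
    obtain a' where a': "a' \<in> I (d + e)" "\<mu> (i + (d + e)) a' = u" using raised[OF a(1), of e] a(2) by blast
    obtain b' where b': "b' \<in> I (d + e)" "\<mu> (i + (d + e)) b' = v"
      using raised[OF b(1), of d] b(2) by (metis add.commute)
    have "hom_add a' b' \<in> I (d + e)" using a' b' alg_add by (auto simp: I_def hom_add_def)
    from U_I[OF this] show ?thesis using a' b' \<mu>_add I_alg by metis
  qed
  have U_mult: "w * u \<in> U \<and> u * w \<in> U" if uw: "u \<in> U" "w \<in> W" for u w
  proof -
    obtain d a where a: "a \<in> I d" "u = \<mu> (i + d) a" using U_E uw by metis
    obtain j b where b: "b \<in> alg j" "w = \<mu> j b" using uw by (auto simp: W_def)
    have e: "j + (i + d) = i + (d + j)" by simp
    obtain a' where a': "a' \<in> I (d + j)" "\<mu> (i + (d + j)) a' = u" using raised[OF a(1), of j] a(2) by blast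
    have b': "\<phi> j (i + d) b \<in> alg (i + (d + j))" "\<mu> (i + (d + j)) (\<phi> j (i + d) b) = w"
      using conn_iter_closed[OF b(1), of "i + d"] \<mu>_conn_iter[OF b(1), of "i + d"] b(2) unfolding e by auto
    have "hom_mult (n (i + (d + j))) a' (\<phi> j (i + d) b) \<in> I (d + j)"
      "hom_mult (n (i + (d + j))) (\<phi> j (i + d) b) a' \<in> I (d + j)"
      using a'(1) b'(1) alg_mult by (auto simp: I_def hom_mult_def)
    then show ?thesis using U_I a' b' \<mu>_mult I_alg by metis
  qed
  have "closed_ideal (closure U)"
    unfolding closed_ideal_def
  proof (intro conjI ballI allI)
    have "(\<lambda>t x r c. 0) \<in> I 0" using alg_zero_elem[of "i + 0"] by (simp add: I_def)
    from U_I[OF this] have "0 \<in> U" by (simp only: \<mu>_zero)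
    then show "0 \<in> closure U" using closure_subset by blast
    fix u assume "u \<in> closure U"
    then obtain us where us: "\<And>m. us m \<in> U" "us \<longlonglongrightarrow> u" unfolding closure_sequential by blast
    show "u + v \<in> closure U" if "v \<in> closure U" for v
    proof -
      obtain vs where vs: "\<And>m. vs m \<in> U" "vs \<longlonglongrightarrow> v" using \<open>v \<in> closure U\<close> unfolding closure_sequential by blast
      show ?thesis unfolding closure_sequential
        by (intro exI[of _ "\<lambda>m. us m + vs m"] conjI allI U_add us vs tendsto_add)
    qed
    fix w
    \<comment> \<open>So far \<open>U\<close> absorbs multiplication only by the dense subalgebra
      \<open>W\<close>; sequences extend this to every element of the limit.\<close>
    have "w \<in> closure W" using \<mu>_dense unfolding W_def by simp
    then obtain ws where ws: "\<And>m. ws m \<in> W" "ws \<longlonglongrightarrow> w" unfolding closure_sequential by blast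
    show "w * u \<in> closure U" unfolding closure_sequential
      by (intro exI[of _ "\<lambda>m. ws m * us m"] conjI allI tendsto_mult us ws) (use U_mult us ws in blast)
    show "u * w \<in> closure U" unfolding closure_sequential
      by (intro exI[of _ "\<lambda>m. us m * ws m"] conjI allI tendsto_mult us ws) (use U_mult us ws in blast)
  qed simp
  then have J: "closure U = {0} \<or> closure U = UNIV" using simple by (simp add: simple_algebra_def)
  note tx = persistent_in[OF pers]
  \<comment> \<open>A tent of height one at \<open>x\<close>, supported in the \<delta>-ball, times
    the unit of summand \<open>t\<close>. It vanishes at the bad points of stage \<open>i\<close>,
    and its value 1 at \<open>x\<close> is seen from every later stage.\<close>
  define h :: "'a hom_elem" where "h s z r c = (if s = t \<and> z \<in> X i t \<and> r = c \<and> r < n i t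
    then of_real (max 0 (1 - dist z x / \<delta>)) else 0)" for s z r c
  have h: "h \<in> alg i"
  proof (rule algI)
    fix s r c assume src: "s < k i" "r < n i s" "c < n i s"
    show "continuous_on (X i s) (\<lambda>z. h s z r c)"
    proof (cases "s = t \<and> r = c")
      case True
      have "continuous_on (X i s) (\<lambda>z. complex_of_real (max 0 (1 - dist z x / \<delta>)))"
        using \<delta> by (intro continuous_intros) auto
      then show ?thesis by (rule continuous_on_eq) (use True src in \<open>auto simp: h_def\<close>)
    qed (auto simp: h_def)
  qed (use tx in \<open>auto simp: h_def\<close>)
  have "h \<in> I 0"
  proof -
    have "h l y r c = 0" if "B 0 l y" for l y r c
    proof (cases "l = t")
      case True
      have "near i t x \<delta> 0 l y" if "dist y x < \<delta>"
        unfolding near_def using that n_pos[of t i] tx True by (intro exI[of _ 0]) simp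
      then have "\<delta> \<le> dist y x" using that unfolding B_def by fastforce
      then show ?thesis using \<delta> by (simp add: h_def)
    qed (simp add: h_def)
    then show ?thesis using h by (simp add: I_def)
  qed
  then have "\<mu> i h \<in> closure U" using U_I[of h 0] closure_subset by auto
  moreover have "1 \<le> norm (\<mu> i h)"
  proof (rule norm_\<mu>_ge[OF h])
    fix d
    obtain l y p where p: "l < k (i + d)" "y \<in> X (i + d) l" "p < n (i + d) l"
      "src i d l p = t" "pt i d l p y = x" using pers unfolding persistent_def by blast
    then have "h (src i d l p) (pt i d l p y) (loc i d l p) (loc i d l p) = 1"
      using tx src_loc_less(2)[OF p(1,3)] by (simp add: h_def)
    then show "\<exists>l y p. l < k (i + d) \<and> y \<in> X (i + d) l \<and> p < n (i + d) l \<and>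
      1 \<le> cmod (h (src i d l p) (pt i d l p y) (loc i d l p) (loc i d l p))" using p by fastforce
  qed
  ultimately have "1 \<in> closure U" using J by fastforce
  then have "\<forall>e>0. \<exists>u\<in>U. dist u 1 < e" by (simp add: closure_approachable)
  moreover have "(0::real) < 1/2" by simp
  ultimately obtain u where u: "u \<in> U" "dist u 1 < 1/2" by blast
  obtain d a where a: "a \<in> I d" "u = \<mu> (i + d) a" using U_E[OF u(1)] by blast
  \<comment> \<open>At bad points \<open>g\<close> agrees with the unit, and bad points of all later
    stages map to such points; so its limit norm is at least 1, although it represents
    \<open>1 - u\<close>.\<close>
  define g where "g = (\<lambda>t x r c. one (i + d) t x r c - a t x r c)"
  have g: "g \<in> alg (i + d)" unfolding g_def by (intro alg_diff alg_unit I_alg a)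
  have "\<mu> (i + d) g = 1 - u" unfolding g_def using \<mu>_diff[OF alg_unit I_alg[OF a(1)]] \<mu>_one a by simp
  moreover have "1 \<le> norm (\<mu> (i + d) g)"
  proof (rule norm_\<mu>_ge[OF g])
    fix e
    obtain l y where B: "B (d + e) l y" using B_ex by blast
    then have l: "l < k (i + d + e)" "y \<in> X (i + d + e) l" by (auto simp: B_def add.assoc)
    have p: "0 < n (i + d + e) l" using n_pos l by blast
    have "a (src (i + d) e l 0) (pt (i + d) e l 0 y) r c = 0" for r c
      using B_pull[OF B p] a(1) by (simp add: I_def)
    then have "g (src (i + d) e l 0) (pt (i + d) e l 0 y) (loc (i + d) e l 0) (loc (i + d) e l 0) = 1"
      using src_loc_less[OF l(1) p] pt_in[OF l(1) p l(2)] by (simp add: g_def hom_unit_def)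
    then show "\<exists>l y p. l < k (i + d + e) \<and> y \<in> X (i + d + e) l \<and> p < n (i + d + e) l \<and>
      1 \<le> cmod (g (src (i + d) e l p) (pt (i + d) e l p y) (loc (i + d) e l p) (loc (i + d) e l p))"
      using p l by fastforce
  qed
  ultimately show False using u(2) by (simp add: dist_norm norm_minus_commute)
qed

end

subsection \<open>Reduction to elements with a zero row and column\<close>

definition invertibles :: "'b::real_normed_algebra_1 set" where
  "invertibles = {x. \<exists>y. x * y = 1 \<and> y * x = 1}"

lemma invertibles_mult:
  assumes "x \<in> invertibles" "y \<in> invertibles"
  shows "x * y \<in> invertibles"
proof -
  obtain x' y' where "x * x' = 1" "x' * x = 1" "y * y' = 1" "y' * y = 1"
    using assms by (auto simp: invertibles_def)
  then have "x * y * (y' * x') = 1" "y' * x' * (x * y) = 1"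
    by (metis mult.assoc mult_1_left)+
  then show ?thesis unfolding invertibles_def by blast
qed

lemma closure_invertibles_mult:
  assumes "g \<in> invertibles" "x \<in> closure invertibles"
  shows "g * x \<in> closure invertibles" "x * g \<in> closure invertibles"
proof -
  obtain xs where xs: "\<And>m. xs m \<in> invertibles" "xs \<longlonglongrightarrow> x"
    using assms(2) unfolding closure_sequential by blast
  show "g * x \<in> closure invertibles" unfolding closure_sequential
    by (intro exI[of _ "\<lambda>m. g * xs m"] conjI allI invertibles_mult assms(1) xs tendsto_intros)
  show "x * g \<in> closure invertibles" unfolding closure_sequential
    by (intro exI[of _ "\<lambda>m. xs m * g"] conjI allI invertibles_mult assms(1) xs tendsto_intros)
qed

lemma closure_invertibles_cancel:
  assumes "g \<in> invertibles" "h \<in> invertibles" "g * x * h \<in> closure invertibles"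
  shows "x \<in> closure invertibles"
proof -
  obtain g' h' where g': "g' * g = 1" "g * g' = 1" and h': "h * h' = 1" "h' * h = 1"
    using assms(1,2) by (auto simp: invertibles_def)
  then have "g' \<in> invertibles" "h' \<in> invertibles" by (auto simp: invertibles_def)
  then have "g' * (g * x * h) * h' \<in> closure invertibles"
    using assms(3) closure_invertibles_mult by blast
  moreover have "g' * (g * x * h) * h' = (g' * g) * x * (h * h')" by (simp add: mult.assoc)
  ultimately show ?thesis using g' h' by simp
qed

text \<open>The geometric series is finite and sums to the inverse.\<close>

lemma one_minus_nilpotent:
  fixes z :: "'b::real_normed_algebra_1"
  assumes "z ^ M = 0"
  shows "1 - z \<in> invertibles"
proof -
  have "(1 - z) * (\<Sum>i<M. z ^ i) = 1 - z ^ M \<and> (\<Sum>i<M. z ^ i) * (1 - z) = 1 - z ^ M"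
  proof (induction M)
    case (Suc M)
    let ?S = "\<Sum>i<M. z ^ i"
    have "(1 - z) * (?S + z ^ M) = (1 - z) * ?S + (z ^ M - z ^ Suc M)"
      "(?S + z ^ M) * (1 - z) = ?S * (1 - z) + (z ^ M - z ^ Suc M)"
      by (simp_all add: algebra_simps power_commutes)
    then show ?case using Suc by simp
  qed simp
  then show ?thesis using assms unfolding invertibles_def by auto
qed

text \<open>Adding the scalar \<open>e / 2\<close> to the nilpotent \<open>g * x\<close> gives a
  positive multiple of one minus a nilpotent, hence an invertible; afterwards \<open>g\<close> is
  cancelled.\<close>

lemma nilpotent_in_closure_invertibles:
  fixes g x :: "'b::real_normed_algebra_1"
  assumes g: "g \<in> invertibles" and nil: "(g * x) ^ M = 0"
  shows "x \<in> closure invertibles"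
proof -
  have "g * x \<in> closure invertibles"
    unfolding closure_approachable
  proof (intro allI impI)
    fix e :: real assume "0 < e"
    define z where "z = (- (2 / e)) *\<^sub>R (g * x)"
    have "z ^ M = 0" by (simp only: z_def scaleR_power nil scaleR_zero_right)
    then have inv: "1 - z \<in> invertibles" by (rule one_minus_nilpotent)
    have "(e / 2) *\<^sub>R 1 \<in> (invertibles :: 'b set)"
      unfolding invertibles_def using \<open>0 < e\<close> by (auto intro!: exI[of _ "(2 / e) *\<^sub>R 1"])
    from invertibles_mult[OF this inv] have "(e / 2) *\<^sub>R 1 + g * x \<in> invertibles"
      using \<open>0 < e\<close> by (simp add: z_def scaleR_add_right)
    moreover have "dist ((e / 2) *\<^sub>R 1 + g * x) (g * x) < e" using \<open>0 < e\<close> by (simp add: dist_norm)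
    ultimately show "\<exists>y\<in>invertibles. dist y (g * x) < e" by blast
  qed
  moreover have "1 \<in> (invertibles :: 'b set)" by (auto simp: invertibles_def)
  ultimately show ?thesis using closure_invertibles_cancel[OF g, of 1 x] by simp
qed

context diag_limit
begin

definition rank_one_update ::
  "nat \<Rightarrow> (nat \<Rightarrow> 'a \<Rightarrow> nat \<Rightarrow> complex) \<Rightarrow> (nat \<Rightarrow> 'a \<Rightarrow> nat \<Rightarrow> complex) \<Rightarrow> 'a hom_elem" where
  "rank_one_update i u z = (\<lambda>t y p q. if t < k i \<and> y \<in> X i t \<and> p < n i t \<and> q < n i t
     then (if p = q then 1 else 0) + u t y p * z t y q else 0)"

lemma rank_one_update_closed:
  assumes "\<And>t p. t < k i \<Longrightarrow> p < n i t \<Longrightarrow> continuous_on (X i t) (\<lambda>y. u t y p)"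
    and "\<And>t p. t < k i \<Longrightarrow> p < n i t \<Longrightarrow> continuous_on (X i t) (\<lambda>y. z t y p)"
  shows "rank_one_update i u z \<in> alg i"
proof (rule algI)
  fix t p q assume tpq: "t < k i" "p < n i t" "q < n i t"
  have "continuous_on (X i t) (\<lambda>y. (if p = q then 1 else 0) + u t y p * z t y q)"
    using tpq assms by (intro continuous_intros)
  then show "continuous_on (X i t) (\<lambda>y. rank_one_update i u z t y p q)"
    by (rule continuous_on_eq) (simp add: rank_one_update_def tpq)
qed (auto simp: rank_one_update_def)

text \<open>With the same \<open>z\<close> in both factors the product is again an update by
  \<open>z\<close>, with first vector \<open>u + v + (z\<^sup>T v) u\<close>; the hypothesis makes
  this vector zero.\<close>

lemma rank_one_update_mult:
  assumes "\<And>t y p. t < k i \<Longrightarrow> y \<in> X i t \<Longrightarrow> p < n i t \<Longrightarrow>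
    u t y p + v t y p + u t y p * (\<Sum>j<n i t. z t y j * v t y j) = 0"
  shows "hom_mult (n i) (rank_one_update i u z) (rank_one_update i v z) = one i"
proof (intro ext)
  fix t y p q
  show "hom_mult (n i) (rank_one_update i u z) (rank_one_update i v z) t y p q = one i t y p q"
  proof (cases "t < k i \<and> y \<in> X i t \<and> p < n i t \<and> q < n i t")
    case True
    let ?d = "\<lambda>p q. if p = q then 1 else 0 :: complex"
    have "hom_mult (n i) (rank_one_update i u z) (rank_one_update i v z) t y p q
      = (\<Sum>j<n i t. (?d p j + u t y p * z t y j) * (?d j q + v t y j * z t y q))"
      using True by (simp add: hom_mult_def rank_one_update_def)
    also have "\<dots> = (\<Sum>j<n i t. if j = p then ?d p q + v t y p * z t y q else 0)
        + (\<Sum>j<n i t. if j = q then u t y p * z t y q else 0)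
        + u t y p * (\<Sum>j<n i t. z t y j * v t y j) * z t y q"
      unfolding sum.distrib[symmetric] sum_distrib_left sum_distrib_right
      by (intro sum.cong) (auto simp: algebra_simps)
    also have "\<dots> = ?d p q + (u t y p + v t y p + u t y p * (\<Sum>j<n i t. z t y j * v t y j)) * z t y q"
      using True by (simp add: algebra_simps)
    also have "\<dots> = ?d p q" using assms[of t y p] True by simp
    finally show ?thesis using True by (simp add: hom_unit_def)
  qed (auto simp: hom_mult_def hom_unit_def rank_one_update_def)
qed

text \<open>The Sherman-Morrison formula: if \<open>c = 1 + z\<^sup>T u\<close> is the determinant,
  the inverse is the update by \<open>- u / c\<close> and the same \<open>z\<close>.\<close>

lemma rank_one_update_invertible:
  assumes u: "\<And>t p. t < k i \<Longrightarrow> p < n i t \<Longrightarrow> continuous_on (X i t) (\<lambda>y. u t y p)"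
    and z: "\<And>t p. t < k i \<Longrightarrow> p < n i t \<Longrightarrow> continuous_on (X i t) (\<lambda>y. z t y p)"
    and nz: "\<And>t y. t < k i \<Longrightarrow> y \<in> X i t \<Longrightarrow> 1 + (\<Sum>j<n i t. z t y j * u t y j) \<noteq> 0"
  shows "\<mu> i (rank_one_update i u z) \<in> invertibles"
proof -
  define c where "c t y = 1 + (\<Sum>j<n i t. z t y j * u t y j)" for t y
  define v where "v t y p = - u t y p / c t y" for t y p
  have c: "continuous_on (X i t) (c t)" if "t < k i" for t
    unfolding c_def using that u z by (intro continuous_intros) auto
  have v: "continuous_on (X i t) (\<lambda>y. v t y p)" if "t < k i" "p < n i t" for t p
    unfolding v_def using that u c nz by (intro continuous_intros) (auto simp: c_def)
  have zv: "(\<Sum>j<n i t. z t y j * v t y j) = - (c t y - 1) / c t y" for t y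
    by (simp add: v_def c_def sum_negf sum_divide_distrib[symmetric])
  have zu: "(\<Sum>j<n i t. z t y j * u t y j) = c t y - 1" for t y by (simp add: c_def)
  have nz': "c t y \<noteq> 0" if "t < k i" "y \<in> X i t" for t y using nz that by (simp add: c_def)
  have "hom_mult (n i) (rank_one_update i u z) (rank_one_update i v z) = one i"
    by (rule rank_one_update_mult, unfold zv) (use nz' in \<open>simp add: v_def field_simps\<close>)
  moreover have "hom_mult (n i) (rank_one_update i v z) (rank_one_update i u z) = one i"
    by (rule rank_one_update_mult, unfold zu) (use nz' in \<open>simp add: v_def field_simps\<close>)
  moreover have "rank_one_update i u z \<in> alg i" "rank_one_update i v z \<in> alg i"
    using u v z by (auto intro!: rank_one_update_closed)
  ultimately show ?thesis using \<mu>_inverse unfolding invertibles_def by blast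
qed

text \<open>The rank one update of the identity by \<open>u - e\<^sub>c\<close> and \<open>z\<close> maps \<open>e\<^sub>c\<close> to \<open>u\<close> when \<open>z\<^sub>c = 1\<close>,
  and its determinant is the pairing of \<open>z\<close> and \<open>u\<close>.\<close>

lemma frame:
  assumes c: "\<And>t. t < k i \<Longrightarrow> c t < n i t" and z: "\<And>t. t < k i \<Longrightarrow> z t (c t) = 1"
    and u: "\<And>t p. t < k i \<Longrightarrow> p < n i t \<Longrightarrow> continuous_on (X i t) (\<lambda>y. u t y p)"
    and nz: "\<And>t y. t < k i \<Longrightarrow> y \<in> X i t \<Longrightarrow> (\<Sum>j<n i t. z t j * u t y j) \<noteq> 0"
  obtains R where "R \<in> alg i" "\<mu> i R \<in> invertibles"
    "\<And>t y p. t < k i \<Longrightarrow> y \<in> X i t \<Longrightarrow> p < n i t \<Longrightarrow> R t y p (c t) = u t y p"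
proof -
  define v where "v t y p = u t y p - (if p = c t then 1 else 0)" for t y p
  have v: "continuous_on (X i t) (\<lambda>y. v t y p)" if "t < k i" "p < n i t" for t p
    unfolding v_def using that u by (intro continuous_intros) auto
  have nz': "1 + (\<Sum>j<n i t. z t j * v t y j) = (\<Sum>j<n i t. z t j * u t y j)" if "t < k i" for t y
  proof -
    have "(\<Sum>j<n i t. z t j * v t y j)
      = (\<Sum>j<n i t. z t j * u t y j) - (\<Sum>j<n i t. if j = c t then z t j else 0)"
      unfolding sum_subtractf[symmetric] by (intro sum.cong) (auto simp: v_def algebra_simps)
    then show ?thesis using c z that by simp
  qed
  show ?thesis
  proof (rule that[of "rank_one_update i v (\<lambda>t _. z t)"])
    show "rank_one_update i v (\<lambda>t _. z t) \<in> alg i" by (intro rank_one_update_closed v continuous_intros)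
    show "\<mu> i (rank_one_update i v (\<lambda>t _. z t)) \<in> invertibles"
      by (intro rank_one_update_invertible v continuous_intros) (simp_all add: nz' nz)
    show "rank_one_update i v (\<lambda>t _. z t) t y p (c t) = u t y p"
      if "t < k i" "y \<in> X i t" "p < n i t" for t y p
      using that c z by (simp add: rank_one_update_def v_def)
  qed
qed

text \<open>Exchanging the two vectors of the update prescribes a row instead of a column.\<close>

lemma coframe:
  assumes c: "\<And>t. t < k i \<Longrightarrow> c t < n i t" and z: "\<And>t. t < k i \<Longrightarrow> z t (c t) = 1"
    and u: "\<And>t p. t < k i \<Longrightarrow> p < n i t \<Longrightarrow> continuous_on (X i t) (\<lambda>y. u t y p)"
    and nz: "\<And>t y. t < k i \<Longrightarrow> y \<in> X i t \<Longrightarrow> (\<Sum>j<n i t. z t j * u t y j) \<noteq> 0"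
  obtains L where "L \<in> alg i" "\<mu> i L \<in> invertibles"
    "\<And>t y q. t < k i \<Longrightarrow> y \<in> X i t \<Longrightarrow> q < n i t \<Longrightarrow> L t y (c t) q = u t y q"
proof -
  define v where "v t y p = u t y p - (if p = c t then 1 else 0)" for t y p
  have v: "continuous_on (X i t) (\<lambda>y. v t y p)" if "t < k i" "p < n i t" for t p
    unfolding v_def using that u by (intro continuous_intros) auto
  have nz': "1 + (\<Sum>j<n i t. v t y j * z t j) = (\<Sum>j<n i t. z t j * u t y j)" if "t < k i" for t y
  proof -
    have "(\<Sum>j<n i t. v t y j * z t j)
      = (\<Sum>j<n i t. z t j * u t y j) - (\<Sum>j<n i t. if j = c t then z t j else 0)"
      unfolding sum_subtractf[symmetric] by (intro sum.cong) (auto simp: v_def algebra_simps)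
    then show ?thesis using c z that by simp
  qed
  show ?thesis
  proof (rule that[of "rank_one_update i (\<lambda>t _. z t) v"])
    show "rank_one_update i (\<lambda>t _. z t) v \<in> alg i" by (intro rank_one_update_closed v continuous_intros)
    show "\<mu> i (rank_one_update i (\<lambda>t _. z t) v) \<in> invertibles"
      by (intro rank_one_update_invertible v continuous_intros) (simp_all add: nz' nz)
    show "rank_one_update i (\<lambda>t _. z t) v t y (c t) q = u t y q"
      if "t < k i" "y \<in> X i t" "q < n i t" for t y q
      using that c z by (simp add: rank_one_update_def v_def)
  qed
qed

lemma sandwich_column:
  assumes "\<And>j. j < n i t \<Longrightarrow> (\<Sum>l<n i t. f t y j l * R t y l c) = 0"
  shows "hom_mult (n i) L (hom_mult (n i) f R) t y p c = 0"
  using assms by (simp add: hom_mult_def)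

lemma sandwich_row:
  assumes "\<And>l. l < n i t \<Longrightarrow> (\<Sum>j<n i t. L t y r j * f t y j l) = 0"
  shows "hom_mult (n i) L (hom_mult (n i) f R) t y r q = 0"
proof -
  have "hom_mult (n i) L (hom_mult (n i) f R) t y r q
      = (\<Sum>j<n i t. \<Sum>l<n i t. L t y r j * f t y j l * R t y l q)"
    by (simp add: hom_mult_def sum_distrib_left mult.assoc)
  also have "\<dots> = (\<Sum>l<n i t. (\<Sum>j<n i t. L t y r j * f t y j l) * R t y l q)"
    by (subst sum.swap) (simp add: sum_distrib_right)
  finally show ?thesis using assms by simp
qed

lemma sandwich_cancel:
  assumes "L \<in> alg i" "f \<in> alg i" "R \<in> alg i" "\<mu> i L \<in> invertibles" "\<mu> i R \<in> invertibles"
    and "\<mu> i (hom_mult (n i) L (hom_mult (n i) f R)) \<in> closure invertibles"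
  shows "\<mu> i f \<in> closure invertibles"
  using assms(6) closure_invertibles_cancel[OF assms(4,5), of "\<mu> i f"] assms(1-3)
  by (simp add: \<mu>_mult alg_mult mult.assoc)

text \<open>By continuity row \<open>r\<close> and column \<open>c\<close> are smaller than \<eta>
  on a ball around \<open>x0\<close>. Damping just these entries inside that ball, down to zero near
  the centre, changes every entry by at most \<eta>.\<close>

lemma cut_off:
  assumes b: "b \<in> alg i" and t: "t < k i" "x0 \<in> X i t" and rc: "r < n i t" "c < n i t"
    and zero: "\<And>p. p < n i t \<Longrightarrow> b t x0 p c = 0" "\<And>p. p < n i t \<Longrightarrow> b t x0 r p = 0"
    and \<eta>: "0 < \<eta>"
  obtains b' \<delta> where "b' \<in> alg i" "0 < \<delta>" "\<And>t x p q. cmod (b t x p q - b' t x p q) \<le> \<eta>"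
    "\<And>x p. x \<in> X i t \<Longrightarrow> dist x x0 < \<delta> \<Longrightarrow> b' t x p c = 0"
    "\<And>x p. x \<in> X i t \<Longrightarrow> dist x x0 < \<delta> \<Longrightarrow> b' t x r p = 0"
proof -
  have ev: "\<forall>\<^sub>F x in at x0 within X i t. cmod (b t x p q) < \<eta>"
    if "p < n i t" "q < n i t" "b t x0 p q = 0" for p q
  proof -
    have "((\<lambda>x. b t x p q) \<longlongrightarrow> 0) (at x0 within X i t)"
      using alg_continuous[OF b t(1) that(1,2)] t(2) that(3) unfolding continuous_on_def by metis
    from tendstoD[OF this \<eta>] show ?thesis by simp
  qed
  have "\<forall>\<^sub>F x in at x0 within X i t. \<forall>p\<in>{..<n i t}. cmod (b t x p c) < \<eta> \<and> cmod (b t x r p) < \<eta>"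
    using ev rc zero by (intro eventually_ball_finite) (auto intro: eventually_conj)
  then obtain d where d: "0 < d" "\<And>x. x \<in> X i t \<Longrightarrow> x \<noteq> x0 \<Longrightarrow> dist x x0 < d \<Longrightarrow>
    \<forall>p\<in>{..<n i t}. cmod (b t x p c) < \<eta> \<and> cmod (b t x r p) < \<eta>"
    unfolding eventually_at by auto
  have small: "cmod (b t x p c) \<le> \<eta> \<and> cmod (b t x r p) \<le> \<eta>" if "dist x x0 < d" for x p
  proof (cases "x \<in> X i t \<and> p < n i t")
    case True
    then show ?thesis using d(2)[of x] that zero \<eta> by (cases "x = x0") (auto simp: less_imp_le)
  next
    case False
    then have "b t x p c = 0" "b t x r p = 0" using alg_zero[OF b] by blast+
    then show ?thesis using \<eta> by simp
  qed
  define \<delta> where "\<delta> = d / 2"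
  have \<delta>: "0 < \<delta>" using d by (simp add: \<delta>_def)
  \<comment> \<open>Equals 1 within radius \<delta> and 0 beyond radius
    \<open>2 * \<delta> = d\<close>, where smallness is no longer known.\<close>
  define cut where "cut x = max 0 (min 1 (2 - dist x x0 / \<delta>))" for x
  define b' where "b' s x p q = (if s = t \<and> (p = r \<or> q = c) then of_real (1 - cut x) * b s x p q
    else b s x p q)" for s x p q
  have cut01: "0 \<le> cut x" "cut x \<le> 1" for x by (auto simp: cut_def)
  have cut_far: "cut x = 0" if "\<not> dist x x0 < d" for x
    using that \<delta> by (simp add: cut_def \<delta>_def field_simps)
  have cut_near: "cut x = 1" if "dist x x0 < \<delta>" for x
  proof -
    have "dist x x0 / \<delta> < 1" using that \<delta> by simp
    then show ?thesis by (simp add: cut_def)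
  qed
  show ?thesis
  proof (rule that[of b' \<delta>])
    show "b' \<in> alg i"
    proof (rule algI)
      fix s p q assume s: "s < k i" "p < n i s" "q < n i s"
      have "continuous_on (X i s) (\<lambda>x. complex_of_real (1 - cut x) * b s x p q)"
        unfolding cut_def using \<delta> s b by (intro continuous_intros alg_continuous) auto
      then show "continuous_on (X i s) (\<lambda>x. b' s x p q)"
        using alg_continuous[OF b s] by (cases "s = t \<and> (p = r \<or> q = c)") (auto simp: b'_def)
    qed (auto simp: b'_def alg_zero[OF b])
    show "0 < \<delta>" by (rule \<delta>)
    show "cmod (b s x p q - b' s x p q) \<le> \<eta>" for s x p q
    proof (cases "s = t \<and> (p = r \<or> q = c)")
      case True
      have "b s x p q - b' s x p q = of_real (cut x) * b s x p q"
        using True by (simp add: b'_def algebra_simps)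
      then have eq: "cmod (b s x p q - b' s x p q) = cut x * cmod (b s x p q)"
        using cut01 by (simp add: norm_mult)
      show ?thesis
      proof (cases "dist x x0 < d")
        case near: True
        have "cmod (b s x p q) \<le> \<eta>" using small[OF near] True by auto
        then have "cut x * cmod (b s x p q) \<le> 1 * \<eta>" using cut01 by (intro mult_mono) auto
        then show ?thesis using eq by simp
      qed (use eq cut_far \<eta> in simp)
    qed (use \<eta> in \<open>auto simp: b'_def\<close>)
  qed (auto simp: b'_def cut_near)
qed

text \<open>Index 0 exists in every summand, so one condition covers summands of different sizes. In
  later stages it gives a zero row and column at each position of local index 0.\<close>

definition zero_cross :: "nat \<Rightarrow> 'a hom_elem \<Rightarrow> bool" where
  "zero_cross i f \<longleftrightarrow> (\<forall>t x p. f t x p 0 = 0 \<and> f t x 0 p = 0)"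

text \<open>In the image of \<open>b\<close>, a position of local index \<open>c\<close> in a block
  whose eigenvalue is near \<open>x0\<close> is a zero column. Such positions depend on the point,
  but weighting them by the bump function of the eigenvalue gives a continuous kernel field, nowhere
  zero by \<open>persistent_near\<close>. Positions of local index \<open>r\<close> do the same for
  rows.\<close>

lemma locally_zero_cross:
  assumes simple: "simple_algebra TYPE('b)"
    and cross: "\<And>j e. e \<in> alg j \<Longrightarrow> zero_cross j e \<Longrightarrow> \<mu> j e \<in> closure invertibles"
    and b: "b \<in> alg i" and pers: "persistent i t x0" and \<delta>: "0 < \<delta>"
    and rc: "r < n i t" "c < n i t"
    and zero: "\<And>x p. x \<in> X i t \<Longrightarrow> dist x x0 < \<delta> \<Longrightarrow> b t x p c = 0"
      "\<And>x p. x \<in> X i t \<Longrightarrow> dist x x0 < \<delta> \<Longrightarrow> b t x r p = 0"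
  shows "\<mu> i b \<in> closure invertibles"
proof -
  obtain d where d: "\<And>l y. l < k (i + d) \<Longrightarrow> y \<in> X (i + d) l \<Longrightarrow> near i t x0 \<delta> d l y"
    using persistent_near[OF simple pers \<delta>] by blast
  define g where "g a l y p = (if src i d l p = t \<and> loc i d l p = a
    then max 0 (\<delta> - dist (pt i d l p y) x0) else 0)" for a l y p
  have g_cont: "continuous_on (X (i + d) l) (\<lambda>y. complex_of_real (g a l y p))"
    if l: "l < k (i + d)" "p < n (i + d) l" for a l p
  proof -
    have "continuous_on (X (i + d) l) (\<lambda>y. complex_of_real (max 0 (\<delta> - dist (pt i d l p y) x0)))"
      using pt_maps[OF l] by (intro continuous_intros) auto
    then show ?thesis by (cases "src i d l p = t \<and> loc i d l p = a") (auto simp: g_def)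
  qed
  \<comment> \<open>The pairing with the all-ones vector is the sum of the weights. Nearness
    provides a block, and \<open>block_full\<close> a position of local index \<open>a\<close> in it
    with positive weight.\<close>
  have g_pos: "(\<Sum>p<n (i + d) l. 1 * complex_of_real (g a l y p)) \<noteq> 0"
    if l: "l < k (i + d)" "y \<in> X (i + d) l" and a: "a < n i t" for a l y
  proof -
    obtain p where p: "p < n (i + d) l" "src i d l p = t" "dist (pt i d l p y) x0 < \<delta>"
      using d[OF l] by (auto simp: near_def)
    obtain q where q: "q < n (i + d) l" "same i d l p q" "loc i d l q = a"
      using block_full[OF l(1) p(1)] a p(2) by blast
    have D: "src i d l q = src i d l p" "pt i d l q = pt i d l p" using sameD[OF q(2) l(1) p(1) q(1)] by auto
    have "0 < g a l y q" using p D q(3) by (simp add: g_def)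
    also have "\<dots> \<le> (\<Sum>p<n (i + d) l. g a l y p)"
      using q(1) by (intro member_le_sum) (auto simp: g_def)
    finally have "(\<Sum>p<n (i + d) l. g a l y p) \<noteq> 0" by simp
    then have "complex_of_real (\<Sum>p<n (i + d) l. g a l y p) \<noteq> 0" by (simp only: of_real_eq_0_iff not_False_eq_True)
    then show ?thesis by simp
  qed
  have near_g: "src i d l p = t \<and> loc i d l p = a \<and> dist (pt i d l p y) x0 < \<delta>"
    if "g a l y p \<noteq> 0" for a l y p
    using that by (auto simp: g_def split: if_splits)
  obtain R where R: "R \<in> alg (i + d)" "\<mu> (i + d) R \<in> invertibles"
    "\<And>l y p. l < k (i + d) \<Longrightarrow> y \<in> X (i + d) l \<Longrightarrow> p < n (i + d) l \<Longrightarrow> R l y p 0 = complex_of_real (g c l y p)"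
    using frame[of "i + d" "\<lambda>_. 0" "\<lambda>_ _. 1" "\<lambda>l y p. complex_of_real (g c l y p)"] n_pos g_cont g_pos[OF _ _ rc(2)]
    by blast
  obtain L where L: "L \<in> alg (i + d)" "\<mu> (i + d) L \<in> invertibles"
    "\<And>l y q. l < k (i + d) \<Longrightarrow> y \<in> X (i + d) l \<Longrightarrow> q < n (i + d) l \<Longrightarrow> L l y 0 q = complex_of_real (g r l y q)"
    using coframe[of "i + d" "\<lambda>_. 0" "\<lambda>_ _. 1" "\<lambda>l y p. complex_of_real (g r l y p)"] n_pos g_cont g_pos[OF _ _ rc(1)]
    by blast
  let ?F = "\<phi> i d b"
  let ?e = "hom_mult (n (i + d)) L (hom_mult (n (i + d)) ?F R)"
  have F: "?F \<in> alg (i + d)" by (rule conn_iter_closed[OF b])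
  have e: "?e \<in> alg (i + d)" by (intro alg_mult L R F)
  have "?e l y p 0 = 0 \<and> ?e l y 0 p = 0" for l y p
  proof (cases "l < k (i + d) \<and> y \<in> X (i + d) l")
    case True
    then have l: "l < k (i + d)" "y \<in> X (i + d) l" by auto
    \<comment> \<open>Each product vanishes by itself: either the weight of \<open>m\<close> is
      zero, or \<open>m\<close> is a zero column of the image at \<open>y\<close>.\<close>
    have "?F l y j m * R l y m 0 = 0" if jm: "j < n (i + d) l" "m < n (i + d) l" for j m
    proof (cases "g c l y m = 0")
      case False
      then have m: "src i d l m = t" "loc i d l m = c" "dist (pt i d l m y) x0 < \<delta>" using near_g by auto
      show ?thesis
      proof (cases "same i d l j m")
        case True
        then have D: "src i d l j = t" "pt i d l j y = pt i d l m y" using sameD[OF True l(1) jm] m by auto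
        have "b t (pt i d l m y) (loc i d l j) c = 0"
          using zero(1) pt_in[OF l(1) jm(2) l(2)] m by auto
        then show ?thesis using D m by (simp add: conn_iter_eq[OF b])
      qed (simp add: conn_iter_eq[OF b])
    qed (use R(3) l jm in simp)
    then have "?e l y p 0 = 0" by (intro sandwich_column sum.neutral) auto
    moreover have "L l y 0 j * ?F l y j m = 0" if jm: "j < n (i + d) l" "m < n (i + d) l" for j m
    proof (cases "g r l y j = 0")
      case False
      then have j: "src i d l j = t" "loc i d l j = r" "dist (pt i d l j y) x0 < \<delta>" using near_g by auto
      have "b t (pt i d l j y) r (loc i d l m) = 0"
        using zero(2) pt_in[OF l(1) jm(1) l(2)] j by auto
      then show ?thesis using j by (simp add: conn_iter_eq[OF b])
    qed (use L(3) l jm in simp)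
    then have "?e l y 0 p = 0" by (intro sandwich_row sum.neutral) auto
    ultimately show ?thesis by simp
  next
    case False
    then show ?thesis using alg_zero[OF e] by blast
  qed
  then have "zero_cross (i + d) ?e" by (simp add: zero_cross_def)
  from cross[OF e this] have "\<mu> (i + d) ?F \<in> closure invertibles"
    by (rule sandwich_cancel[OF L(1) F R(1) L(2) R(2)])
  then show ?thesis by (simp add: \<mu>_conn_iter[OF b])
qed

lemma persistent_singular_in_closure:
  assumes simple: "simple_algebra TYPE('b)"
    and cross: "\<And>j e. e \<in> alg j \<Longrightarrow> zero_cross j e \<Longrightarrow> \<mu> j e \<in> closure invertibles"
    and f: "f \<in> alg i" and pers: "persistent i t x0" and sing: "singular (n i t) (f t x0)"
  shows "\<mu> i f \<in> closure invertibles"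
proof -
  note t = persistent_in[OF pers]
  obtain v c where c: "c < n i t" "v c \<noteq> 0" and v: "\<forall>r<n i t. (\<Sum>j<n i t. f t x0 r j * v j) = 0"
    using sing by (auto simp: singular_def)
  obtain w r where r: "r < n i t" "w r \<noteq> 0" and w: "\<forall>q<n i t. (\<Sum>j<n i t. f t x0 j q * w j) = 0"
    using sing singular_transpose[of "n i t" "f t x0"] by (auto simp: singular_def)
  \<comment> \<open>\<open>frame\<close> wants data on every summand. On \<open>t\<close> the new
    column is the constant kernel vector; elsewhere column 0 is the basis vector
    \<open>e\<^sub>0\<close>, which makes the update the identity there. The functional
    \<open>z\<close> reads the coordinate \<open>C a s\<close>, nonzero by the choice of
    \<open>c\<close> and \<open>r\<close>.\<close>
  define C where "C a s = (if s = t then a else 0)" for a s :: nat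
  define u where "u v s y p = (if s = t then v p else if p = 0 then 1 else 0)"
    for v :: "nat \<Rightarrow> complex" and s :: nat and y :: 'a and p :: nat
  define z where "z a s q = (if q = C a s then 1 else 0 :: complex)" for a s q
  have C: "C a s < n i s" if "a < n i t" "s < k i" for a s using that n_pos by (auto simp: C_def)
  have zu: "(\<Sum>j<n i s. z a s j * u v s y j) \<noteq> 0" if "a < n i t" "v a \<noteq> 0" "s < k i" for a v s y
  proof -
    have "(\<Sum>j<n i s. z a s j * u v s y j) = (\<Sum>j<n i s. if j = C a s then u v s y j else 0)"
      by (intro sum.cong) (auto simp: z_def)
    also have "\<dots> = u v s y (C a s)" using C that by simp
    finally show ?thesis using that by (simp add: u_def C_def)
  qed
  have u_cont: "continuous_on (X i s) (\<lambda>y. u v s y p)" for v s p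
    by (auto simp: u_def)
  obtain R where R: "R \<in> alg i" "\<mu> i R \<in> invertibles"
    "\<And>s y p. s < k i \<Longrightarrow> y \<in> X i s \<Longrightarrow> p < n i s \<Longrightarrow> R s y p (C c s) = u v s y p"
    using frame[of i "C c" "z c" "u v"] C zu[where a = c and v = v, OF c] c u_cont by (auto simp: z_def)
  obtain L where L: "L \<in> alg i" "\<mu> i L \<in> invertibles"
    "\<And>s y q. s < k i \<Longrightarrow> y \<in> X i s \<Longrightarrow> q < n i s \<Longrightarrow> L s y (C r s) q = u w s y q"
    using coframe[of i "C r" "z r" "u w"] C zu[where a = r and v = w, OF r] r u_cont by (auto simp: z_def)
  have R_col: "R t x0 p c = v p" if "p < n i t" for p
    using R(3)[of t x0 p] that t by (simp add: C_def u_def)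
  have L_row: "L t x0 r q = w q" if "q < n i t" for q
    using L(3)[of t x0 q] that t by (simp add: C_def u_def)
  define b where "b = hom_mult (n i) L (hom_mult (n i) f R)"
  have b: "b \<in> alg i" unfolding b_def by (intro alg_mult L R f)
  have zero: "b t x0 p c = 0" "b t x0 r p = 0" for p
    unfolding b_def using v w by (intro sandwich_column sandwich_row; simp add: R_col L_row mult.commute)+
  \<comment> \<open>The approximants are themselves only known to lie in the closure of the
    invertibles.\<close>
  have "\<mu> i b \<in> closure (closure invertibles)"
    unfolding closure_approachable[of _ "closure invertibles"]
  proof (intro allI impI)
    fix e :: real assume "0 < e"
    define N where "N = real (\<Sum>t<k i. n i t)"
    \<comment> \<open>An entrywise error \<eta> costs at most \<open>N * \<eta>\<close> in the limit
      norm; \<open>N + 1\<close> keeps the denominator visibly positive.\<close>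
    define \<eta> where "\<eta> = e / 2 / (N + 1)"
    have N: "0 \<le> N" by (simp add: N_def sum_nonneg)
    then have \<eta>: "0 < \<eta>" using \<open>0 < e\<close> by (simp add: \<eta>_def)
    have N\<eta>: "N * \<eta> < e"
    proof -
      have cancel: "c * (a / c) = a" if "c \<noteq> 0" for a c :: real using that by simp
      have "N * \<eta> \<le> (N + 1) * \<eta>" using \<eta> by (intro mult_right_mono) auto
      also have "(N + 1) * \<eta> = e / 2" unfolding \<eta>_def by (rule cancel) (use N in linarith)
      finally show ?thesis using \<open>0 < e\<close> by simp
    qed
    obtain b' \<delta> where b': "b' \<in> alg i" "0 < \<delta>" "\<And>t x p q. cmod (b t x p q - b' t x p q) \<le> \<eta>"
      "\<And>x p. x \<in> X i t \<Longrightarrow> dist x x0 < \<delta> \<Longrightarrow> b' t x p c = 0"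
      "\<And>x p. x \<in> X i t \<Longrightarrow> dist x x0 < \<delta> \<Longrightarrow> b' t x r p = 0"
    proof (rule cut_off[OF b conjunct1[OF t] conjunct2[OF t] r(1) c(1) _ _ \<eta>])
      show "b t x0 p c = 0" "b t x0 r p = 0" for p by (rule zero)+
    qed (rule that)
    have "\<mu> i b' \<in> closure invertibles"
      by (rule locally_zero_cross[OF simple cross b'(1) pers b'(2) r(1) c(1) b'(4,5)])
    moreover have "norm (\<mu> i b - \<mu> i b') \<le> N * \<eta>"
      unfolding \<mu>_diff[OF b b'(1), symmetric] N_def
      by (rule norm_\<mu>_le) (use alg_diff[OF b b'(1)] b'(3) \<eta> in auto)
    then have "dist (\<mu> i b') (\<mu> i b) < e" using N\<eta> by (simp add: dist_norm norm_minus_commute)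
    ultimately show "\<exists>y\<in>closure invertibles. dist y (\<mu> i b) < e" by blast
  qed
  then show ?thesis by (intro sandwich_cancel[OF L(1) f R(1) L(2) R(2)]) (simp add: b_def)
qed

end

subsection \<open>Triangularization\<close>

text \<open>Listing the positions outside \<open>Z\<close> first gives ranks \<open>\<kappa>\<close>; the cyclic shift \<open>\<pi>\<close> by \<open>card Z\<close> then
  outweighs a band of width \<open>m\<close>.\<close>

lemma shift_permutation:
  assumes Z: "Z \<subseteq> {..<N}" and m: "0 < m" "m \<le> card Z"
  obtains \<pi> \<kappa> :: "nat \<Rightarrow> nat" where "bij_betw \<pi> {..<N} {..<N}" "\<And>p. p < N \<Longrightarrow> \<kappa> p < N"
    "\<And>p q. p < N \<Longrightarrow> q < N \<Longrightarrow> \<pi> p \<notin> Z \<Longrightarrow> q \<notin> Z \<Longrightarrow> q < \<pi> p + m \<Longrightarrow> \<kappa> q < \<kappa> p"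
proof -
  have fin: "finite Z" using Z finite_subset by blast
  define z where "z = card Z"
  have zN: "z \<le> N" using Z card_mono[of "{..<N}" Z] by (simp add: z_def)
  define \<kappa> where "\<kappa> q = (if q \<in> Z then N - z + card {p\<in>Z. p < q} else card {p. p < q \<and> p \<notin> Z})" for q
  have comp: "card {p. p < N \<and> p \<notin> Z} = N - z"
  proof -
    have "{p. p < N \<and> p \<notin> Z} = {..<N} - Z" by auto
    then show ?thesis using card_Diff_subset[OF fin Z] by (simp add: z_def)
  qed
  have low: "\<kappa> q < N - z" if "q < N" "q \<notin> Z" for q
  proof -
    have "{p. p < q \<and> p \<notin> Z} \<subset> {p. p < N \<and> p \<notin> Z}" using that by auto
    from psubset_card_mono[OF _ this] show ?thesis using that comp by (simp add: \<kappa>_def)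
  qed
  have high: "N - z \<le> \<kappa> q \<and> \<kappa> q < N" if "q \<in> Z" for q
  proof -
    have "{p\<in>Z. p < q} \<subset> Z" using that by auto
    from psubset_card_mono[OF fin this] have "card {p\<in>Z. p < q} < z" by (simp add: z_def)
    moreover have "\<kappa> q = N - z + card {p\<in>Z. p < q}" using that by (simp add: \<kappa>_def)
    ultimately show ?thesis using zN by arith
  qed
  have \<kappa>_less: "\<kappa> q < N" if "q < N" for q using low[OF that] high[of q] by (cases "q \<in> Z") auto
  have mono: "\<kappa> q < \<kappa> q'" if "q < q'" "q \<in> Z \<longleftrightarrow> q' \<in> Z" for q q'
  proof (cases "q \<in> Z")
    case True
    then have "{p\<in>Z. p < q} \<subset> {p\<in>Z. p < q'}" using that by auto
    then have "card {p\<in>Z. p < q} < card {p\<in>Z. p < q'}" using fin by (intro psubset_card_mono) auto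
    then show ?thesis using True that by (simp add: \<kappa>_def)
  next
    case False
    then have "{p. p < q \<and> p \<notin> Z} \<subset> {p. p < q' \<and> p \<notin> Z}" using that by auto
    then have "card {p. p < q \<and> p \<notin> Z} < card {p. p < q' \<and> p \<notin> Z}" by (intro psubset_card_mono) auto
    then show ?thesis using False that by (simp add: \<kappa>_def)
  qed
  have inj: "inj_on \<kappa> {..<N}"
  proof (rule inj_onI)
    fix q q' assume q: "q \<in> {..<N}" "q' \<in> {..<N}" and eq: "\<kappa> q = \<kappa> q'"
    then have "q \<in> Z \<longleftrightarrow> q' \<in> Z" using low[of q] low[of q'] high[of q] high[of q']
      by (metis lessThan_iff not_less)
    then show "q = q'" using mono[of q q'] mono[of q' q] eq by (metis less_irrefl linorder_neqE_nat)
  qed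
  then have "\<kappa> ` {..<N} = {..<N}" using \<kappa>_less by (intro endo_inj_surj) auto
  with inj have bij: "bij_betw \<kappa> {..<N} {..<N}" by (simp add: bij_betw_def)
  \<comment> \<open>Ranks drop by \<open>z\<close>; the lowest \<open>z\<close> ranks wrap around to
    the top, which is where the elements of \<open>Z\<close> are ranked.\<close>
  define s where "s x = (if x < z then x + (N - z) else x - z)" for x
  have s: "bij_betw s {..<N} {..<N}"
  proof (rule bij_betw_byWitness[where f' = "\<lambda>x. if x < N - z then x + z else x - (N - z)"])
  qed (use zN in \<open>auto simp: s_def\<close>)
  define \<pi> where "\<pi> p = inv_into {..<N} \<kappa> (s (\<kappa> p))" for p
  have \<pi>: "bij_betw \<pi> {..<N} {..<N}"
    using bij_betw_trans[OF bij_betw_trans[OF bij s] bij_betw_inv_into[OF bij]]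
    by (simp add: \<pi>_def[abs_def] comp_def)
  have \<kappa>\<pi>: "\<kappa> (\<pi> p) = s (\<kappa> p)" if "p < N" for p
    unfolding \<pi>_def using bij s \<kappa>_less[OF that]
    by (intro f_inv_into_f) (auto simp: bij_betw_def)
  have "\<kappa> q < \<kappa> p" if pq: "p < N" "q < N" "\<pi> p \<notin> Z" "q \<notin> Z" "q < \<pi> p + m" for p q
  proof -
    have "\<pi> p < N" using \<pi> pq(1) by (auto simp: bij_betw_def)
    then have lt: "s (\<kappa> p) < N - z" using low[of "\<pi> p"] pq \<kappa>\<pi> by simp
    \<comment> \<open>A wrapped rank would place \<open>\<pi> p\<close> in \<open>Z\<close>, so here
      the shift is a plain drop by \<open>z\<close>.\<close>
    then have eq: "\<kappa> p = \<kappa> (\<pi> p) + z" using \<kappa>\<pi>[OF pq(1)] by (auto simp: s_def split: if_splits)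
    \<comment> \<open>Going from \<open>\<pi> p\<close> up to \<open>q\<close> adds at most one rank
      per position, fewer than \<open>m\<close> in all, which the gain of \<open>z \<ge> m\<close>
      outweighs.\<close>
    have "\<kappa> q \<le> \<kappa> (\<pi> p) + (q - \<pi> p)"
    proof (cases "\<pi> p < q")
      case True
      have "{p'. p' < q \<and> p' \<notin> Z} \<subseteq> {p'. p' < \<pi> p \<and> p' \<notin> Z} \<union> {\<pi> p..<q}" by auto
      then have "card {p'. p' < q \<and> p' \<notin> Z} \<le> card ({p'. p' < \<pi> p \<and> p' \<notin> Z} \<union> {\<pi> p..<q})"
        by (intro card_mono) auto
      also have "\<dots> \<le> card {p'. p' < \<pi> p \<and> p' \<notin> Z} + (q - \<pi> p)"
        using card_Un_le[of _ "{\<pi> p..<q}"] by simp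
      finally show ?thesis using pq by (simp add: \<kappa>_def)
    next
      case False
      then have "q = \<pi> p \<or> q < \<pi> p" by linarith
      then show ?thesis using mono[of q "\<pi> p"] pq by auto
    qed
    moreover have "q - \<pi> p < z"
    proof (cases "\<pi> p < q")
      case False
      then show ?thesis using m by (simp add: z_def)
    qed (use pq(5) m in \<open>simp add: z_def\<close>)
    ultimately show ?thesis using eq by linarith
  qed
  then show ?thesis using that \<pi> \<kappa>_less by blast
qed

context diag_system
begin

lemma block_size_le:
  assumes "l < k (i + d)" "p < n (i + d) l"
  shows "n i (src i d l p) \<le> card {q \<in> {..<n (i + d) l}. same i d l p q}"
    "n i (src i d l p) \<le> n (i + d) l"
proof -
  have eq: "card {q \<in> {..<n (i + d) l}. same i d l p q} = n i (src i d l p)"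
    using bij_betw_same_card[OF loc_bij_betw[OF assms]] by simp
  then show "n i (src i d l p) \<le> card {q \<in> {..<n (i + d) l}. same i d l p q}" by simp
  have "card {q \<in> {..<n (i + d) l}. same i d l p q} \<le> card {..<n (i + d) l}"
    by (intro card_mono) auto
  with eq show "n i (src i d l p) \<le> n (i + d) l" by simp
qed

text \<open>A lower bound for the number of blocks: each has one position of local index 0, and
  every position lies less than the total size of stage \<open>i\<close> beyond the start of its
  block.\<close>

lemma size_le_blocks:
  assumes l: "l < k (i + d)"
  shows "n (i + d) l \<le> card {p. p < n (i + d) l \<and> loc i d l p = 0} * (\<Sum>t<k i. n i t)"
proof -
  let ?Z = "{p. p < n (i + d) l \<and> loc i d l p = 0}" and ?m = "\<Sum>t<k i. n i t"
  have "{..<n (i + d) l} \<subseteq> (\<Union>q\<in>?Z. (\<lambda>a. q + a) ` {..<?m})"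
  proof
    fix p assume "p \<in> {..<n (i + d) l}"
    then have p: "p < n (i + d) l" by simp
    note sl = src_loc_less[OF l p]
    obtain q where q: "q < n (i + d) l" "same i d l p q" "loc i d l q = 0"
      using block_full[OF l p, of 0] n_pos[OF sl(1)] by blast
    then have "p = q + loc i d l p" using sameD[OF q(2) l p q(1)] by simp
    moreover have "n i (src i d l p) \<le> ?m" using sl(1) by (intro member_le_sum) auto
    then have "loc i d l p < ?m" using sl(2) by linarith
    ultimately show "p \<in> (\<Union>q\<in>?Z. (\<lambda>a. q + a) ` {..<?m})" using q by blast
  qed
  then have "card {..<n (i + d) l} \<le> card (\<Union>q\<in>?Z. (\<lambda>a. q + a) ` {..<?m})" by (intro card_mono) auto
  also have "\<dots> \<le> (\<Sum>q\<in>?Z. card ((\<lambda>a. q + a) ` {..<?m}))" by (intro card_UN_le) auto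
  also have "\<dots> = card ?Z * ?m" by (simp add: card_image)
  finally show ?thesis by simp
qed

end

context diag_limit
begin

lemma permutation_invertible:
  assumes \<pi>: "\<And>l. l < k i \<Longrightarrow> bij_betw (\<pi> l) {..<n i l} {..<n i l}"
  defines "T \<equiv> (\<lambda>l y p q. if l < k i \<and> y \<in> X i l \<and> p < n i l \<and> q < n i l \<and> q = \<pi> l p then 1 else 0)"
  shows "T \<in> alg i" "\<mu> i T \<in> invertibles"
proof -
  define S :: "'a hom_elem" where
    "S l y p q = (if l < k i \<and> y \<in> X i l \<and> p < n i l \<and> q < n i l \<and> p = \<pi> l q then 1 else 0)" for l y p q
  have indicator: "(\<lambda>l y p q. if l < k i \<and> y \<in> X i l \<and> p < n i l \<and> q < n i l \<and> P l p q then 1 else 0) \<in> alg i"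
    for P :: "nat \<Rightarrow> nat \<Rightarrow> nat \<Rightarrow> bool"
  proof (rule algI)
    fix l p q assume l: "l < k i" "p < n i l" "q < n i l"
    show "continuous_on (X i l) (\<lambda>y. if l < k i \<and> y \<in> X i l \<and> p < n i l \<and> q < n i l \<and> P l p q then 1 else 0 :: complex)"
      by (rule continuous_on_eq[of _ "\<lambda>_. if P l p q then 1 else 0"]) (use l in auto)
  qed auto
  show T: "T \<in> alg i" unfolding T_def by (rule indicator)
  have S: "S \<in> alg i" unfolding S_def[abs_def] by (rule indicator)
  have "hom_mult (n i) T S l y p q = one i l y p q" for l y p q
  proof (cases "l < k i \<and> y \<in> X i l \<and> p < n i l \<and> q < n i l")
    case True
    have "\<pi> l p < n i l" using \<pi>[of l] True by (auto simp: bij_betw_def)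
    moreover have "\<pi> l p = \<pi> l q \<longleftrightarrow> p = q" using \<pi>[of l] True by (auto simp: bij_betw_def inj_on_def)
    moreover have "hom_mult (n i) T S l y p q = (\<Sum>j<n i l. if j = \<pi> l p then (if \<pi> l p = \<pi> l q then 1 else 0) else 0)"
      unfolding hom_mult_def by (intro sum.cong) (use True in \<open>auto simp: T_def S_def\<close>)
    ultimately show ?thesis using True by (simp add: hom_unit_def)
  qed (auto simp: hom_mult_def hom_unit_def T_def S_def)
  moreover have "hom_mult (n i) S T l y p q = one i l y p q" for l y p q
  proof (cases "l < k i \<and> y \<in> X i l \<and> p < n i l \<and> q < n i l")
    case True
    then have "p \<in> \<pi> l ` {..<n i l}" using \<pi>[of l] by (simp add: bij_betw_def)
    then obtain j where j: "j < n i l" "\<pi> l j = p" by auto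
    have j_unique: "j' = j" if "j' < n i l" "\<pi> l j' = p" for j'
      using \<pi>[of l] True that j by (auto simp: bij_betw_def inj_on_def)
    have "hom_mult (n i) S T l y p q = (\<Sum>j'<n i l. if j' = j then (if p = q then 1 else 0) else 0)"
      unfolding hom_mult_def
    proof (intro sum.cong refl)
      fix j' assume j': "j' \<in> {..<n i l}"
      show "S l y p j' * T l y j' q = (if j' = j then (if p = q then 1 else 0) else 0)"
      proof (cases "j' = j")
        case False
        then have "p \<noteq> \<pi> l j'" using j_unique j' by blast
        then show ?thesis using False by (simp add: S_def)
      qed (use True j in \<open>simp add: S_def T_def eq_commute[of q]\<close>)
    qed
    then show ?thesis using True j by (simp add: hom_unit_def)
  qed (auto simp: hom_mult_def hom_unit_def T_def S_def)
  ultimately have "hom_mult (n i) T S = one i" "hom_mult (n i) S T = one i" by (auto simp: fun_eq_iff)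
  then show "\<mu> i T \<in> invertibles" using \<mu>_inverse[OF T S] unfolding invertibles_def by blast
qed

text \<open>Along a nonzero entry each factor lowers the rank \<kappa> by at least one. A power
  exceeding all possible ranks therefore has no nonzero entry; the sum of the sizes is such an
  exponent for all summands at once.\<close>

lemma triangular_nilpotent:
  assumes f: "f \<in> alg i"
    and \<kappa>: "\<And>l p. l < k i \<Longrightarrow> p < n i l \<Longrightarrow> \<kappa> l p < n i l"
    and tri: "\<And>l y p q. l < k i \<Longrightarrow> p < n i l \<Longrightarrow> q < n i l \<Longrightarrow> f l y p q \<noteq> 0 \<Longrightarrow> \<kappa> l q < (\<kappa> l p :: nat)"
  shows "\<exists>M. \<mu> i f ^ M = 0"
proof -
  have "\<exists>g\<in>alg i. \<mu> i g = \<mu> i f ^ M \<and> (\<forall>l y p q. g l y p q \<noteq> 0 \<longrightarrow> \<kappa> l q + M \<le> \<kappa> l p)" for M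
  proof (induction M)
    case 0
    show ?case by (intro bexI[of _ "one i"] alg_unit conjI) (simp add: \<mu>_one, simp add: hom_unit_def)
  next
    case (Suc M)
    then obtain g where g: "g \<in> alg i" "\<mu> i g = \<mu> i f ^ M"
      "\<And>l y p q. g l y p q \<noteq> 0 \<Longrightarrow> \<kappa> l q + M \<le> \<kappa> l p" by blast
    have "\<kappa> l q + Suc M \<le> \<kappa> l p" if nz: "hom_mult (n i) f g l y p q \<noteq> 0" for l y p q
    proof -
      have v: "l < k i" "p < n i l" using alg_zero[OF alg_mult[OF f g(1)]] nz by blast+
      obtain j where "j < n i l" "f l y p j * g l y j q \<noteq> 0"
        using nz unfolding hom_mult_def by (meson lessThan_iff sum.not_neutral_contains_not_neutral)
      then have "\<kappa> l j < \<kappa> l p" "\<kappa> l q + M \<le> \<kappa> l j" using tri v g(3) by auto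
      then show ?thesis by simp
    qed
    then show ?case using alg_mult[OF f g(1)] \<mu>_mult[OF f g(1)] g(2)
      by (intro bexI[of _ "hom_mult (n i) f g"]) auto
  qed
  then obtain g where g: "g \<in> alg i" "\<mu> i g = \<mu> i f ^ (\<Sum>l<k i. n i l)"
    "\<And>l y p q. g l y p q \<noteq> 0 \<Longrightarrow> \<kappa> l q + (\<Sum>l<k i. n i l) \<le> \<kappa> l p" by blast
  have "g l y p q = 0" for l y p q
  proof (rule ccontr)
    assume nz: "g l y p q \<noteq> 0"
    then have v: "l < k i" "p < n i l" using alg_zero[OF g(1)] by blast+
    have "n i l \<le> (\<Sum>l<k i. n i l)" using v by (intro member_le_sum) auto
    then show False using g(3)[OF nz] \<kappa>[OF v] by linarith
  qed
  then have "g = (\<lambda>l y p q. 0)" by (simp add: fun_eq_iff)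
  then show ?thesis using g(2) \<mu>_zero by metis
qed

lemma zero_cross_in_closure:
  assumes growth: "\<And>M. \<exists>l. \<forall>t<k l. M \<le> n l t"
    and e: "e \<in> alg i" and cross: "zero_cross i e"
  shows "\<mu> i e \<in> closure invertibles"
proof -
  define m where "m = (\<Sum>t<k i. n i t)"
  \<comment> \<open>Blocks have size at most \<open>m\<close>, so size at least \<open>m * m\<close>
    forces at least \<open>m\<close> blocks, as many free positions as the band is wide.\<close>
  obtain j where j: "\<And>t. t < k j \<Longrightarrow> m * m \<le> n j t" using growth by blast
  let ?F = "\<phi> i j e"
  have F: "?F \<in> alg (i + j)" by (rule conn_iter_closed[OF e])
  define Z where "Z l = {p. p < n (i + j) l \<and> loc i j l p = 0}" for l
  have "n i 0 \<le> m" unfolding m_def using k_pos by (intro member_le_sum) auto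
  then have m: "0 < m" using n_pos[OF k_pos, of i] by simp
  have Z: "m \<le> card (Z l)" if l: "l < k (i + j)" for l
  proof -
    \<comment> \<open>Stage \<open>i + j\<close> is also \<open>i\<close> steps after stage
      \<open>j\<close>; its summands contain whole blocks from stage \<open>j\<close> and so are at
      least as large.\<close>
    have l': "l < k (j + i)" using l by (simp add: add.commute)
    have "m * m \<le> n (j + i) l"
      using block_size_le(2)[OF l' n_pos[OF l']] j[OF src_loc_less(1)[OF l' n_pos[OF l']]] by linarith
    also have "\<dots> \<le> card (Z l) * m" using size_le_blocks[OF l] by (simp add: Z_def m_def add.commute)
    finally show ?thesis using m by simp
  qed
  have "\<exists>\<pi> \<kappa>. bij_betw \<pi> {..<n (i + j) l} {..<n (i + j) l} \<and> (\<forall>p<n (i + j) l. \<kappa> p < n (i + j) l) \<and>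
      (\<forall>p<n (i + j) l. \<forall>q<n (i + j) l. \<pi> p \<notin> Z l \<longrightarrow> q \<notin> Z l \<longrightarrow> q < \<pi> p + m \<longrightarrow> \<kappa> q < (\<kappa> p :: nat))"
    if l: "l < k (i + j)" for l
  proof -
    have "Z l \<subseteq> {..<n (i + j) l}" by (auto simp: Z_def)
    from shift_permutation[OF this m Z[OF l]] show ?thesis by metis
  qed
  then obtain \<pi> \<kappa> where \<pi>: "\<And>l. l < k (i + j) \<Longrightarrow> bij_betw (\<pi> l) {..<n (i + j) l} {..<n (i + j) l}"
    and \<kappa>: "\<And>l p. l < k (i + j) \<Longrightarrow> p < n (i + j) l \<Longrightarrow> \<kappa> l p < n (i + j) l"
    and \<pi>\<kappa>: "\<And>l p q. l < k (i + j) \<Longrightarrow> p < n (i + j) l \<Longrightarrow> q < n (i + j) l \<Longrightarrow> \<pi> l p \<notin> Z l \<Longrightarrow> q \<notin> Z l \<Longrightarrow>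
      q < \<pi> l p + m \<Longrightarrow> \<kappa> l q < (\<kappa> l p :: nat)"
    by metis
  define T :: "'a hom_elem" where "T = (\<lambda>l y p q. if l < k (i + j) \<and> y \<in> X (i + j) l \<and>
    p < n (i + j) l \<and> q < n (i + j) l \<and> q = \<pi> l p then 1 else 0)"
  note T = permutation_invertible[of "i + j" \<pi>, OF \<pi>, folded T_def]
  \<comment> \<open>Nonzero entries stay within one block, which gives the band, and avoid its zero
    row and column, which gives \<open>Z\<close>.\<close>
  have F_band: "p \<notin> Z l \<and> q \<notin> Z l \<and> q < p + m" if nz: "?F l y p q \<noteq> 0" for l y p q
  proof -
    have v: "l < k (i + j)" "p < n (i + j) l" "q < n (i + j) l" "same i j l p q"
      and nz': "e (src i j l p) (pt i j l p y) (loc i j l p) (loc i j l q) \<noteq> 0"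
      using nz by (auto simp: conn_iter_eq[OF e] split: if_splits)
    have "loc i j l p \<noteq> 0" "loc i j l q \<noteq> 0" using nz' cross unfolding zero_cross_def by metis+
    moreover have "q < p + m"
    proof -
      have "src i j l q < k i" "loc i j l q < n i (src i j l q)" using src_loc_less v by auto
      moreover from this have "n i (src i j l q) \<le> m" unfolding m_def by (intro member_le_sum) auto
      ultimately show ?thesis using sameD[OF v(4,1,2,3)] by linarith
    qed
    ultimately show ?thesis by (simp add: Z_def)
  qed
  let ?G = "hom_mult (n (i + j)) T ?F"
  have G: "?G \<in> alg (i + j)" by (intro alg_mult T F \<pi>)
  have "\<kappa> l q < \<kappa> l p" if l: "l < k (i + j)" "p < n (i + j) l" "q < n (i + j) l" and nz: "?G l y p q \<noteq> 0" for l y p q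
  proof -
    \<comment> \<open>Left multiplication by \<open>T\<close> makes row \<open>p\<close> of the
      product equal to row \<open>\<pi> l p\<close> of the image.\<close>
    obtain r where "r < n (i + j) l" "T l y p r * ?F l y r q \<noteq> 0"
      using nz unfolding hom_mult_def by (meson lessThan_iff sum.not_neutral_contains_not_neutral)
    then have "r = \<pi> l p" "?F l y r q \<noteq> 0" by (auto simp: T_def split: if_splits)
    then show ?thesis using F_band[of l y r q] \<pi>\<kappa> l by blast
  qed
  then obtain M where "\<mu> (i + j) ?G ^ M = 0"
    using triangular_nilpotent[OF G, of \<kappa>] \<kappa> by blast
  then have "\<mu> (i + j) ?F \<in> closure invertibles"
    using nilpotent_in_closure_invertibles[OF T(2)] \<pi> \<mu>_mult[OF T(1) F] by metis
  then show ?thesis by (simp add: \<mu>_conn_iter[OF e])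
qed

end

section \<open>Bounded matrix sizes\<close>

lemma singular_cong:
  assumes "\<And>r c. r < m \<Longrightarrow> c < m \<Longrightarrow> M r c = M' r c"
  shows "singular m M \<longleftrightarrow> singular m M'"
  using assms by (simp add: singular_def)

context diag_system
begin

text \<open>The minimal size \<open>s\<close> of the summands does not decrease along the sequence. Once it is constant,
  a summand of minimal size contains a block of size at least \<open>s\<close>, hence is a single block.\<close>

lemma eventually_single_block:
  assumes bound: "\<And>d. \<exists>t<k (i + d). n (i + d) t < M"
  obtains d where "\<And>e. \<exists>l<k (i + d + e). \<forall>p<n (i + d + e) l. \<forall>q<n (i + d + e) l.
    src (i + d) e l p = src (i + d) e l q \<and> pt (i + d) e l p = pt (i + d) e l q"
proof -
  define P where "P s \<longleftrightarrow> (\<exists>d. \<forall>t<k (i + d). s \<le> n (i + d) t)" for s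
  have "P 0" by (simp add: P_def)
  have P_le: "s \<le> M" if "P s" for s
  proof -
    obtain d where d: "\<forall>t<k (i + d). s \<le> n (i + d) t" using \<open>P s\<close> unfolding P_def by blast
    obtain t where "t < k (i + d)" "n (i + d) t < M" using bound by blast
    with d show ?thesis by fastforce
  qed
  define s where "s = Greatest P"
  have s: "P s" "\<And>s'. P s' \<Longrightarrow> s' \<le> s"
    unfolding s_def using GreatestI_nat[of P 0 M] Greatest_le_nat[of P _ M] \<open>P 0\<close> P_le by blast+
  obtain d where d: "\<And>t. t < k (i + d) \<Longrightarrow> s \<le> n (i + d) t" using s(1) by (auto simp: P_def)
  show ?thesis
  proof (rule that[of d], rule ccontr)
    fix e
    assume neg: "\<not> (\<exists>l<k (i + d + e). \<forall>p<n (i + d + e) l. \<forall>q<n (i + d + e) l.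
      src (i + d) e l p = src (i + d) e l q \<and> pt (i + d) e l p = pt (i + d) e l q)"
    have "Suc s \<le> n (i + d + e) l" if l: "l < k (i + d + e)" for l
    proof (rule ccontr)
      assume small: "\<not> Suc s \<le> n (i + d + e) l"
      have p0: "0 < n (i + d + e) l" using n_pos[OF l] .
      let ?Q = "{q \<in> {..<n (i + d + e) l}. same (i + d) e l 0 q}"
      have "s \<le> n (i + d) (src (i + d) e l 0)" using d src_loc_less(1)[OF l p0] by blast
      \<comment> \<open>The block of position 0 has at least \<open>s\<close> positions, and a small
        summand has at most \<open>s\<close>; so this block fills the summand.\<close>
      then have "card {..<n (i + d + e) l} \<le> card ?Q"
        using block_size_le(1)[OF l p0] small by simp
      then have Q: "?Q = {..<n (i + d + e) l}" by (intro card_seteq) auto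
      have "src (i + d) e l q = src (i + d) e l 0 \<and> pt (i + d) e l q = pt (i + d) e l 0"
        if "q < n (i + d + e) l" for q
        using sameD[OF _ l p0 that] that Q by blast
      then show False using neg l by metis
    qed
    then have "P (Suc s)" unfolding P_def by (intro exI[of _ "d + e"]) (auto simp: add.assoc)
    then show False using s(2) by force
  qed
qed

lemma near_add_all:
  assumes "\<And>l y. l < k (i + d) \<Longrightarrow> y \<in> X (i + d) l \<Longrightarrow> near i t x \<delta> d l y"
    and l: "l < k (i + d + e)" "y \<in> X (i + d + e) l"
  shows "near i t x \<delta> (d + e) l y"
  using near_add[OF l(1) n_pos[OF l(1)]] assms(1) src_loc_less[OF l(1) n_pos[OF l(1)]]
    pt_in[OF l(1) n_pos[OF l(1)] l(2)] by blast

end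

context diag_limit
begin

text \<open>At a common later stage every point has eigenvalues near each of the two persistent
  points. In a summand with a single eigenvalue map both are the same value, so the persistent
  points are arbitrarily close.\<close>

lemma persistent_unique:
  assumes simple: "simple_algebra TYPE('b)"
    and single: "\<And>d. \<exists>l<k (i + d). \<forall>p<n (i + d) l. \<forall>q<n (i + d) l.
      src i d l p = src i d l q \<and> pt i d l p = pt i d l q"
    and pers: "persistent i t x" "persistent i t' x'"
  shows "t' = t \<and> x' = x"
proof -
  have close: "t' = t \<and> dist x x' < 2 * \<delta>" if \<delta>: "0 < \<delta>" for \<delta>
  proof -
    obtain d where d: "\<And>l y. l < k (i + d) \<Longrightarrow> y \<in> X (i + d) l \<Longrightarrow> near i t x \<delta> d l y"
      using persistent_near[OF simple pers(1) \<delta>] by blast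
    obtain d' where d': "\<And>l y. l < k (i + d') \<Longrightarrow> y \<in> X (i + d') l \<Longrightarrow> near i t' x' \<delta> d' l y"
      using persistent_near[OF simple pers(2) \<delta>] by blast
    obtain l where l: "l < k (i + (d + d'))" and one: "\<forall>p<n (i + (d + d')) l. \<forall>q<n (i + (d + d')) l.
      src i (d + d') l p = src i (d + d') l q \<and> pt i (d + d') l p = pt i (d + d') l q"
      using single by blast
    obtain y where y: "y \<in> X (i + (d + d')) l" using X_nonempty[OF l] by blast
    have "near i t x \<delta> (d + d') l y"
      using near_add_all[OF d, of l d' y] l y by (simp add: add.assoc)
    moreover have "near i t' x' \<delta> (d' + d) l y"
      using near_add_all[OF d', of l d y] l y by (simp add: add.assoc add.commute[of d'])
    then have "near i t' x' \<delta> (d + d') l y" by (simp add: add.commute)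
    ultimately obtain p p' where "p < n (i + (d + d')) l" "p' < n (i + (d + d')) l"
      "src i (d + d') l p = t" "src i (d + d') l p' = t'"
      "dist (pt i (d + d') l p y) x < \<delta>" "dist (pt i (d + d') l p' y) x' < \<delta>"
      unfolding near_def by blast
    moreover from this one have "src i (d + d') l p = src i (d + d') l p'"
      "pt i (d + d') l p = pt i (d + d') l p'" by blast+
    ultimately show ?thesis
      using dist_triangle3[of x x' "pt i (d + d') l p y"] by auto
  qed
  have "dist x x' = 0"
  proof (rule ccontr)
    assume "dist x x' \<noteq> 0"
    then show False using close[of "dist x x' / 2"] by simp
  qed
  then show ?thesis using close[of 1] by simp
qed

lemma single_block_in_closure:
  assumes simple: "simple_algebra TYPE('b)"
    and single: "\<And>d. \<exists>l<k (i + d). \<forall>p<n (i + d) l. \<forall>q<n (i + d) l.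
      src i d l p = src i d l q \<and> pt i d l p = pt i d l q"
    and f: "f \<in> alg i"
  shows "\<mu> i f \<in> closure invertibles"
  unfolding closure_approachable
proof (intro allI impI)
  fix e :: real assume e: "0 < e"
  define N where "N = real (\<Sum>t<k i. n i t)"
  have N: "0 \<le> N" by (simp add: N_def sum_nonneg)
  \<comment> \<open>If there is no persistent point, any \<open>t\<close> and \<open>x\<close>
    serve.\<close>
  obtain t x where tx: "\<And>t' x'. persistent i t' x' \<Longrightarrow> t' = t \<and> x' = x"
    using persistent_unique[OF simple single] by metis
  obtain \<delta> where \<delta>: "0 < \<delta>" "\<delta> < e / (N + 1)"
    "\<not> singular (n i t) (\<lambda>r c. f t x r c + (if r = c then complex_of_real \<delta> else 0))"
    by (rule nonsingular_perturbation[of "e / (N + 1)" "n i t" "f t x"]) (use e N in auto)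
  define h :: "'a hom_elem" where "h s y r c = of_real \<delta> * one i s y r c" for s y r c
  have h: "h \<in> alg i"
    unfolding h_def[abs_def]
    by (rule algI) (auto intro!: continuous_intros alg_continuous[OF alg_unit] simp: alg_zero[OF alg_unit])
  have "cmod (h s y r c) \<le> \<delta>" for s y r c using \<delta>(1) by (simp add: h_def hom_unit_def)
  then have "norm (\<mu> i h) \<le> N * \<delta>" unfolding N_def using h \<delta>(1) by (intro norm_\<mu>_le) auto
  also have "\<dots> \<le> (N + 1) * \<delta>" using \<delta>(1) by (intro mult_right_mono) auto
  also have "\<dots> < e" using \<delta>(2) N by (simp add: pos_less_divide_eq mult.commute)
  finally have "dist (\<mu> i (hom_add f h)) (\<mu> i f) < e" by (simp add: \<mu>_add[OF f h] dist_norm)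
  moreover have "\<mu> i (hom_add f h) \<in> invertibles"
  proof -
    have "\<not> singular (n i t') (hom_add f h t' x')" if pers: "persistent i t' x'" for t' x'
    proof -
      have eq: "t' = t" "x' = x" using tx pers by blast+
      have "hom_add f h t x r c = f t x r c + (if r = c then complex_of_real \<delta> else 0)"
        if "r < n i t" for r c
        using persistent_in[OF pers] that eq by (simp add: hom_add_def h_def hom_unit_def)
      then have "singular (n i t) (hom_add f h t x)
          \<longleftrightarrow> singular (n i t) (\<lambda>r c. f t x r c + (if r = c then complex_of_real \<delta> else 0))"
        by (intro singular_cong)
      then show ?thesis using \<delta>(3) eq by simp
    qed
    then show ?thesis
      using invertible_or_persistent_singular[OF alg_add[OF f h]] unfolding invertibles_def by blast
  qed
  ultimately show "\<exists>y\<in>invertibles. dist y (\<mu> i f) < e" by blast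
qed

lemma \<mu>_in_closure_invertibles:
  assumes simple: "simple_algebra TYPE('b)" and f: "f \<in> alg i"
  shows "\<mu> i f \<in> closure invertibles"
proof (cases "\<forall>M. \<exists>l. \<forall>t<k l. M \<le> n l t")
  case True
  then have cross: "\<mu> j e \<in> closure invertibles" if "e \<in> alg j" "zero_cross j e" for j e
    using zero_cross_in_closure that by blast
  from invertible_or_persistent_singular[OF f] show ?thesis
  proof
    assume "\<exists>b. \<mu> i f * b = 1 \<and> b * \<mu> i f = 1"
    then have "\<mu> i f \<in> invertibles" by (simp add: invertibles_def)
    then show ?thesis using closure_subset by blast
  next
    assume "\<exists>t x. persistent i t x \<and> singular (n i t) (f t x)"
    then show ?thesis using persistent_singular_in_closure[OF simple cross f] by blast
  qed
next
  case False
  \<comment> \<open>If the minimal sizes do not tend past every bound, some \<open>M\<close> exceeds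
    the minimal size at every stage; \<open>f\<close> is then replaced by its image at a stage from
    which single blocks recur forever.\<close>
  then obtain M where "\<And>l. \<exists>t<k l. n l t < M" by (meson not_le)
  then have "\<And>d. \<exists>t<k (i + d). n (i + d) t < M" by blast
  from eventually_single_block[OF this] obtain d where "\<And>e. \<exists>l<k (i + d + e).
    \<forall>p<n (i + d + e) l. \<forall>q<n (i + d + e) l.
    src (i + d) e l p = src (i + d) e l q \<and> pt (i + d) e l p = pt (i + d) e l q" by metis
  from single_block_in_closure[OF simple this conn_iter_closed[OF f]]
  show ?thesis by (simp add: \<mu>_conn_iter[OF f])
qed

end

theorem theorem4p1:
  fixes k :: "nat \<Rightarrow> nat"
    and n :: "nat \<Rightarrow> nat \<Rightarrow> nat"
    and X :: "nat \<Rightarrow> nat \<Rightarrow> 'a::metric_space set"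
    and mlt :: "nat \<Rightarrow> nat \<Rightarrow> nat \<Rightarrow> nat"
    and lam :: "nat \<Rightarrow> nat \<Rightarrow> nat \<Rightarrow> nat \<Rightarrow> 'a \<Rightarrow> 'a"
    and \<mu> :: "nat \<Rightarrow> 'a hom_elem \<Rightarrow> 'b::{banach, real_normed_algebra_1}"
  assumes spaces: "\<And>i t. t < k i \<Longrightarrow>
      compact (X i t) \<and> connected (X i t) \<and> X i t \<noteq> {} \<and> 1 \<le> n i t"
    and diagonal: "\<And>i. is_diagonal (k i) (n i) (X i) (k (Suc i)) (n (Suc i)) (X (Suc i))
                          (mlt i) (lam i)"
    and limit: "is_inductive_limit k n X mlt lam \<mu>"
    and simple: "simple_algebra TYPE('b)"
  shows "stable_rank_one TYPE('b)"
proof -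
  interpret diag_limit k n X mlt lam \<mu>
    using spaces diagonal limit by unfold_locales (auto simp: Suc_le_eq)
  have "(\<Union>i. \<mu> i ` hom_carrier (k i) (n i) (X i)) \<subseteq> closure invertibles"
    using \<mu>_in_closure_invertibles[OF simple] by blast
  then have "closure (\<Union>i. \<mu> i ` hom_carrier (k i) (n i) (X i)) \<subseteq> closure (invertibles :: 'b set)"
    by (rule closure_minimal) simp
  then show ?thesis
    using \<mu>_dense by (auto simp: stable_rank_one_def invertibles_def[symmetric])
qed

end
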